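(* For every integer $n\geq 1$, $H^i(Q_n,\mathbb{Z})=0$ for all $i>\lfloor (n+1)/3\rfloor$.
   Context: Let $S^1$ be the circle with a fixed point $\infty\in S^1$, let $T^{n-1}=\{(x_1,\ldots,x_{n-1})\mid x_i\in S^1\}$ be the $(n-1)$-dimensional torus and set $x_n=\infty$. For $1\leq i<j<k\leq n$ let $A_{ijk}\subset T^{n-1}$ be the subset of points satisfying $x_i=x_j=x_k$, and let $A_n=\bigcup_{1\leq i<j<k\leq n}A_{ijk}$. The space $Q_n$ is the complement $T^{n-1}\setminus A_n$ (the space of configurations of $n$ ordered points on the circle, no three of which coincide, with the last point fixed at $\infty$). *)

theory Defs
  imports "HOL-Homology.Homology"
begin

section \<open>Singular cohomology with coefficients in an abelian group\<close>

text \<open>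
  Cochains are homomorphisms from the singular chain group to the coefficient group.  As usual for
  functions on a carrier, they are made \<^const>\<open>extensional\<close>, so that two cochains agreeing on
  all chains are equal.
\<close>

definition cochain_group ::
    "nat \<Rightarrow> 'a topology \<Rightarrow> ('g, 'm) monoid_scheme \<Rightarrow> ('a chain \<Rightarrow> 'g) monoid"
  where "cochain_group p X G \<equiv>
    \<lparr>carrier = hom (chain_group p X) G \<inter> extensional (carrier (chain_group p X)),
     monoid.mult = (\<lambda>\<phi> \<psi>. \<lambda>c\<in>carrier (chain_group p X). \<phi> c \<otimes>\<^bsub>G\<^esub> \<psi> c),
     one = (\<lambda>c\<in>carrier (chain_group p X). \<one>\<^bsub>G\<^esub>)\<rparr>"

definition coboundary :: "nat \<Rightarrow> 'a topology \<Rightarrow> ('a chain \<Rightarrow> 'g) \<Rightarrow> ('a chain \<Rightarrow> 'g)"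
  where "coboundary p X \<phi> \<equiv>
    \<lambda>c\<in>carrier (chain_group (Suc p) X). \<phi> (chain_boundary (Suc p) c)"

definition singular_cocycles ::
    "nat \<Rightarrow> 'a topology \<Rightarrow> ('g, 'm) monoid_scheme \<Rightarrow> ('a chain \<Rightarrow> 'g) set"
  where "singular_cocycles p X G \<equiv>
    kernel (cochain_group p X G) (cochain_group (Suc p) X G) (coboundary p X)"

fun singular_coboundaries ::
    "nat \<Rightarrow> 'a topology \<Rightarrow> ('g, 'm) monoid_scheme \<Rightarrow> ('a chain \<Rightarrow> 'g) set"
  where
    "singular_coboundaries 0 X G = {\<one>\<^bsub>cochain_group 0 X G\<^esub>}"
  | "singular_coboundaries (Suc p) X G = coboundary p X ` carrier (cochain_group p X G)"

definition cocycle_group ::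
    "nat \<Rightarrow> 'a topology \<Rightarrow> ('g, 'm) monoid_scheme \<Rightarrow> ('a chain \<Rightarrow> 'g) monoid"
  where "cocycle_group p X G \<equiv> (cochain_group p X G)\<lparr>carrier := singular_cocycles p X G\<rparr>"

definition cohomology_group ::
    "nat \<Rightarrow> 'a topology \<Rightarrow> ('g, 'm) monoid_scheme \<Rightarrow> ('a chain \<Rightarrow> 'g) set monoid"
  where "cohomology_group p X G \<equiv> cocycle_group p X G Mod singular_coboundaries p X G"

lemma carrier_cochain_group:
  "\<phi> \<in> carrier (cochain_group p X G) \<longleftrightarrow>
     \<phi> \<in> hom (chain_group p X) G \<and> \<phi> \<in> extensional (singular_chain_set p X)"
  by (simp add: cochain_group_def)

lemma mult_cochain_group:
  "\<phi> \<otimes>\<^bsub>cochain_group p X G\<^esub> \<psi> = (\<lambda>c\<in>singular_chain_set p X. \<phi> c \<otimes>\<^bsub>G\<^esub> \<psi> c)"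
  by (simp add: cochain_group_def)

lemma one_cochain_group:
  "\<one>\<^bsub>cochain_group p X G\<^esub> = (\<lambda>c\<in>singular_chain_set p X. \<one>\<^bsub>G\<^esub>)"
  by (simp add: cochain_group_def)

lemma comm_group_cochain_group:
  assumes "comm_group G"
  shows "comm_group (cochain_group p X G)"
proof -
  interpret G: comm_group G by fact
  show ?thesis
  proof (rule comm_groupI)
    fix \<phi> \<psi>
    assume "\<phi> \<in> carrier (cochain_group p X G)" "\<psi> \<in> carrier (cochain_group p X G)"
    then show "\<phi> \<otimes>\<^bsub>cochain_group p X G\<^esub> \<psi> \<in> carrier (cochain_group p X G)"
      by (auto simp: carrier_cochain_group mult_cochain_group hom_def Pi_iff
                     singular_chain_add G.m_ac)
  next
    fix \<phi> assume \<phi>: "\<phi> \<in> carrier (cochain_group p X G)"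
    define \<psi> where "\<psi> = (\<lambda>c\<in>singular_chain_set p X. inv\<^bsub>G\<^esub> (\<phi> c))"
    have "\<psi> \<in> carrier (cochain_group p X G)"
      using \<phi> by (auto simp: \<psi>_def carrier_cochain_group hom_def Pi_iff
                             singular_chain_add G.inv_mult)
    moreover have "\<psi> \<otimes>\<^bsub>cochain_group p X G\<^esub> \<phi> = \<one>\<^bsub>cochain_group p X G\<^esub>"
      using \<phi> by (auto simp: \<psi>_def carrier_cochain_group mult_cochain_group one_cochain_group
                             hom_def Pi_iff intro!: restrict_ext)
    ultimately show "\<exists>\<psi>\<in>carrier (cochain_group p X G).
        \<psi> \<otimes>\<^bsub>cochain_group p X G\<^esub> \<phi> = \<one>\<^bsub>cochain_group p X G\<^esub>"
      by blast
  next
    fix \<phi> assume "\<phi> \<in> carrier (cochain_group p X G)"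
    then show "\<one>\<^bsub>cochain_group p X G\<^esub> \<otimes>\<^bsub>cochain_group p X G\<^esub> \<phi> = \<phi>"
      by (auto simp: carrier_cochain_group mult_cochain_group one_cochain_group
                     hom_def Pi_iff extensional_def)
  qed (auto simp: carrier_cochain_group mult_cochain_group one_cochain_group hom_def Pi_iff
                  singular_chain_add G.m_ac intro!: restrict_ext)
qed

lemma coboundary_hom:
  assumes "comm_group G"
  shows "coboundary p X \<in> hom (cochain_group p X G) (cochain_group (Suc p) X G)"
proof -
  interpret G: comm_group G by fact
  show ?thesis
    by (auto simp: hom_def Pi_iff coboundary_def carrier_cochain_group mult_cochain_group
                   singular_chain_add chain_boundary_add singular_chain_boundary_alt
             intro!: restrict_ext)
qed

lemma coboundary_coboundary:
  assumes "comm_group G" and \<phi>: "\<phi> \<in> carrier (cochain_group p X G)"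
  shows "coboundary (Suc p) X (coboundary p X \<phi>) = \<one>\<^bsub>cochain_group (Suc (Suc p)) X G\<^esub>"
proof -
  interpret G: comm_group G by fact
  interpret h: group_hom "chain_group p X" G \<phi>
    using \<phi> by (simp add: carrier_cochain_group group_hom_def group_hom_axioms_def G.is_group)
  have "\<phi> 0 = \<one>\<^bsub>G\<^esub>"
    using h.hom_one by simp
  then show ?thesis
    by (auto simp: coboundary_def one_cochain_group singular_chain_boundary_alt
                   chain_boundary_boundary_alt intro!: restrict_ext)
qed

lemma subgroup_singular_cocycles:
  assumes "comm_group G"
  shows "subgroup (singular_cocycles p X G) (cochain_group p X G)"
  unfolding singular_cocycles_def
  by (intro group_hom.subgroup_kernel)
     (simp add: group_hom_def group_hom_axioms_def coboundary_hom assms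
                comm_group.axioms(2) comm_group_cochain_group)

lemma comm_group_cocycle_group:
  assumes "comm_group G"
  shows "comm_group (cocycle_group p X G)"
proof -
  interpret C: comm_group "cochain_group p X G"
    by (rule comm_group_cochain_group[OF assms])
  have sub: "subgroup (singular_cocycles p X G) (cochain_group p X G)"
    by (rule subgroup_singular_cocycles[OF assms])
  have "group (cocycle_group p X G)"
    unfolding cocycle_group_def by (rule subgroup.subgroup_is_group[OF sub C.is_group])
  then show ?thesis
    using subgroup.subset[OF sub]
    by (intro group.group_comm_groupI) (auto simp: cocycle_group_def intro!: C.m_comm)
qed

lemma normal_singular_coboundaries:
  assumes "comm_group G"
  shows "singular_coboundaries p X G \<lhd> cocycle_group p X G"
proof -
  have grp: "group (cochain_group q X G)" for q
    by (simp add: assms comm_group.axioms(2) comm_group_cochain_group)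
  have sub: "subgroup (singular_coboundaries p X G) (cochain_group p X G)"
  proof (cases p)
    case 0
    then show ?thesis
      by (simp add: group.triv_subgroup grp)
  next
    case (Suc q)
    interpret group_hom "cochain_group q X G" "cochain_group (Suc q) X G" "coboundary q X"
      by (simp add: group_hom_def group_hom_axioms_def coboundary_hom assms grp)
    show ?thesis
      using img_is_subgroup Suc by simp
  qed
  have "singular_coboundaries p X G \<subseteq> singular_cocycles p X G"
  proof (cases p)
    case 0
    then show ?thesis
      using subgroup.one_closed[OF subgroup_singular_cocycles[OF assms, of p X]] by simp
  next
    case (Suc q)
    then show ?thesis
      using coboundary_hom[OF assms, of q X]
      by (auto simp: singular_cocycles_def kernel_def hom_def coboundary_coboundary[OF assms])
  qed
  then have "subgroup (singular_coboundaries p X G) (cocycle_group p X G)"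
    unfolding cocycle_group_def
    by (intro group.subgroup_incl grp sub subgroup_singular_cocycles assms)
  then show ?thesis
    by (simp add: comm_group.normal_iff_subgroup comm_group_cocycle_group assms)
qed

lemma group_cohomology_group:
  assumes "comm_group G"
  shows "group (cohomology_group p X G)"
  unfolding cohomology_group_def
  by (rule normal.factorgroup_is_group[OF normal_singular_coboundaries[OF assms]])


section \<open>The space of configurations without triple collisions on the circle\<close>

abbreviation circle :: "complex topology"
  where "circle \<equiv> top_of_set (sphere 0 1)"

text \<open>The \<open>(n - 1)\<close>-dimensional torus, with coordinates indexed by \<open>1, \<dots>, n - 1\<close>.\<close>

definition torus :: "nat \<Rightarrow> (nat \<Rightarrow> complex) topology"
  where "torus n \<equiv> product_topology (\<lambda>_. circle) {1..<n}"

text \<open>The update \<open>x(n := b)\<close> is the convention that the last point is fixed at the base point \<open>b\<close>.\<close>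

definition triple_diagonal :: "nat \<Rightarrow> complex \<Rightarrow> nat \<Rightarrow> nat \<Rightarrow> nat \<Rightarrow> (nat \<Rightarrow> complex) set"
  where "triple_diagonal n b i j k \<equiv>
    {x \<in> topspace (torus n). (x(n := b)) i = (x(n := b)) j \<and> (x(n := b)) j = (x(n := b)) k}"

definition triple_collisions :: "nat \<Rightarrow> complex \<Rightarrow> (nat \<Rightarrow> complex) set"
  where "triple_collisions n b \<equiv>
    \<Union> {triple_diagonal n b i j k | i j k. 1 \<le> i \<and> i < j \<and> j < k \<and> k \<le> n}"

definition no_triple_config_space :: "nat \<Rightarrow> complex \<Rightarrow> (nat \<Rightarrow> complex) topology"
  where "no_triple_config_space n b \<equiv>
    subtopology (torus n) (topspace (torus n) - triple_collisions n b)"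

lemma topspace_no_triple_config_space:
  "topspace (no_triple_config_space n b) =
     {x \<in> {1..<n} \<rightarrow>\<^sub>E sphere 0 1. \<forall>i j k. 1 \<le> i \<and> i < j \<and> j < k \<and> k \<le> n \<longrightarrow>
        \<not> ((x(n := b)) i = (x(n := b)) j \<and> (x(n := b)) j = (x(n := b)) k)}"
  unfolding no_triple_config_space_def triple_collisions_def triple_diagonal_def torus_def
  by (simp del: fun_upd_apply) blast

end

theory Submission
  imports Defs
begin

text \<open>
  Cutting the circle at the base point, the configurations in which no point sits at the base
  point form an open set equivalent to the space \<open>M\<^sub>m\<close> of \<open>m = n - 1\<close> labelled points on the line
  without triple collisions; the rest is a disjoint union of codimension-one strata \<open>x\<^sub>i = b\<close>, each
  equivalent to \<open>M\<^sub>m\<close> with \<open>m = n - 2\<close>. Mayer--Vietoris therefore reduces the bound to the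
  vanishing of \<open>H\<^sup>p(M\<^sub>m)\<close> for \<open>p > m div 3\<close>.

  On the line, either one point is leftmost, or exactly two points share the leftmost position. So
  \<open>M\<^sub>m\<close> is glued from copies of \<open>M\<^sub>m\<^sub>-\<^sub>1\<close> along copies of \<open>M\<^sub>m\<^sub>-\<^sub>2\<close>, and induction gives the vanishing
  except in degree \<open>m div 3 + 1\<close> when \<open>m mod 3 = 2\<close>. There one needs that the top cohomology of each
  \<open>M\<^sub>m\<^sub>-\<^sub>1\<close> surjects onto the sum of the top cohomologies of its strata with a given leftmost point;
  this surjectivity follows from the same Mayer--Vietoris sequence for \<open>M\<^sub>m\<^sub>-\<^sub>1\<close>.
\<close>

text \<open>The bound is fixed by the strata: a stratum, and also its overlap with the remaining
  open set, involves \<open>n - 2\<close> moving points, and the connecting map raises the degree by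
  one, whence \<open>(n - 2) div 3 + 1 = (n + 1) div 3\<close>. On the line the same count fails
  exactly for \<open>m = 3 * q + 2\<close>: overlaps then involve \<open>3 * q\<close> points, which
  may have cohomology in degree \<open>q\<close>, and this would feed into degree
  \<open>q + 1\<close>. The remedy is that dropping the leftmost point \<open>i\<close> turns the
  overlaps inside the stratum of \<open>i\<close> into the strata of a configuration of
  \<open>3 * q + 1\<close> points. In that smaller space the overlaps involve
  \<open>3 * q - 1\<close> points and have nothing in degree \<open>q\<close>, so arbitrary classes
  on its strata extend, and the extension restricts to the stratum of \<open>i\<close>. Closed
  strata and tubular neighbourhoods are avoided: each stratum is replaced by an explicit open set,
  pairwise disjoint within its family, so that a whole family is handled by one Mayer-Vietoris step.
  As chain groups are free, a cochain is an integer function on simplices and can be glued simplex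
  by simplex.\<close>

section \<open>Integral cochains\<close>

text \<open>\<open>frag_extend\<close> takes values in a free abelian group, so the integers enter
  as the free group on \<open>()\<close>; reading off its single coefficient makes the linear
  extension of \<open>c\<close> integer-valued.\<close>

definition ev :: "('s \<Rightarrow> int) \<Rightarrow> ('s \<Rightarrow>\<^sub>0 int) \<Rightarrow> int"
  where "ev c z = poly_mapping.lookup (frag_extend (\<lambda>s. frag_cmul (c s) (frag_of ())) z) ()"

lemma ev_0 [simp]: "ev c 0 = 0"
  by (simp add: ev_def)

lemma ev_of [simp]: "ev c (frag_of s) = c s"
  by (simp add: ev_def)

lemma ev_add: "ev c (x + y) = ev c x + ev c y"
  by (simp add: ev_def frag_extend_add lookup_add)

lemma ev_diff: "ev c (x - y) = ev c x - ev c y"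
  by (simp add: ev_def frag_extend_diff lookup_minus)

lemma ev_cmul: "ev c (frag_cmul k x) = k * ev c x"
  by (simp add: ev_def frag_extend_cmul)

text \<open>A linear functional is determined by the generators in the support. Additivity is
  phrased with differences because \<open>frag_induction\<close> builds chains from zero, generators
  and differences.\<close>

lemma ev_unique:
  assumes "Poly_Mapping.keys z \<subseteq> K"
    and "\<And>x y. f (x - y) = (f x - f y :: int)"
    and "\<And>s. s \<in> K \<Longrightarrow> f (frag_of s) = c s"
  shows "ev c z = f z"
  using assms(1)
proof (induction z rule: frag_induction)
  case zero
  then show ?case using assms(2)[of 0 0] by simp
qed (auto simp: ev_diff assms(2,3))

lemma ev_cong:
  assumes "\<And>s. s \<in> Poly_Mapping.keys z \<Longrightarrow> c s = d s"
  shows "ev c z = ev d z"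
  by (rule ev_unique[OF order_refl]) (auto simp: ev_diff assms)

lemma ev_cochain_diff: "ev (\<lambda>s. c s - d s) z = ev c z - ev d z"
  by (rule ev_unique[of z UNIV]) (auto simp: ev_diff)

lemma ev_cochain_add: "ev (\<lambda>s. c s + d s) z = ev c z + ev d z"
  by (rule ev_unique[of z UNIV]) (auto simp: ev_diff)

lemma ev_cochain_0: "ev (\<lambda>s. 0) z = 0"
  by (rule ev_unique[of z UNIV, where f = "\<lambda>_. 0"]) auto

lemma ev_compose:
  assumes "\<And>x y. h (x - y) = h x - h y"
  shows "ev (\<lambda>s. ev c (h (frag_of s))) z = ev c (h z)"
  by (rule ev_unique[of z UNIV]) (auto simp: assms ev_diff)

text \<open>A cochain is a function on all maps, not only on the simplices of \<open>X\<close>, so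
  restricting it to a subspace leaves the function unchanged and only narrows the chains quantified
  over.\<close>

definition closed_cochain :: "nat \<Rightarrow> 'a topology \<Rightarrow> (((nat \<Rightarrow> real) \<Rightarrow> 'a) \<Rightarrow> int) \<Rightarrow> bool"
  where "closed_cochain p X c \<longleftrightarrow>
    (\<forall>z. singular_chain (Suc p) X z \<longrightarrow> ev c (chain_boundary (Suc p) z) = 0)"

text \<open>Since \<^term>\<open>chain_boundary 0\<close> is zero, an exact cochain of degree zero vanishes.\<close>

definition exact_cochain :: "nat \<Rightarrow> 'a topology \<Rightarrow> (((nat \<Rightarrow> real) \<Rightarrow> 'a) \<Rightarrow> int) \<Rightarrow> bool"
  where "exact_cochain p X c \<longleftrightarrow>
    (\<exists>e. \<forall>z. singular_chain p X z \<longrightarrow> ev c z = ev e (chain_boundary p z))"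

definition cohomology_vanishes :: "nat \<Rightarrow> 'a topology \<Rightarrow> bool"
  where "cohomology_vanishes p X \<longleftrightarrow> (\<forall>c. closed_cochain p X c \<longrightarrow> exact_cochain p X c)"

lemma closed_cochain_0: "closed_cochain p X (\<lambda>s. 0)"
  by (simp add: closed_cochain_def ev_cochain_0)

lemma exact_cochain_add:
  assumes "exact_cochain p X c" "exact_cochain p X d"
  shows "exact_cochain p X (\<lambda>s. c s + d s)"
proof -
  obtain e e' where
    "\<And>z. singular_chain p X z \<Longrightarrow> ev c z = ev e (chain_boundary p z)"
    "\<And>z. singular_chain p X z \<Longrightarrow> ev d z = ev e' (chain_boundary p z)"
    using assms by (auto simp: exact_cochain_def)
  then show ?thesis
    unfolding exact_cochain_def
    by (intro exI[of _ "\<lambda>s. e s + e' s"]) (simp add: ev_cochain_add)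
qed

lemma ev_eq_on_chain:
  assumes "singular_chain p X z" "\<And>s. singular_simplex p X s \<Longrightarrow> c s = d s"
  shows "ev c z = ev d z"
  by (rule ev_cong) (use assms in \<open>auto simp: singular_chain_def\<close>)

lemma exact_cochain_cong:
  assumes "exact_cochain p X c" "\<And>s. singular_simplex p X s \<Longrightarrow> c s = d s"
  shows "exact_cochain p X d"
  using assms ev_eq_on_chain[of p X _ c d] unfolding exact_cochain_def by metis

lemma exact_cochain_empty: "topspace X = {} \<Longrightarrow> exact_cochain p X c"
  by (auto simp: exact_cochain_def singular_chain_empty)

lemma closed_cochain_subtopology:
  assumes "closed_cochain p (subtopology X S) c" "T \<subseteq> S"
  shows "closed_cochain p (subtopology X T) c"
  using assms singular_chain_mono unfolding closed_cochain_def by blast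

lemma exact_cochain_subtopology:
  assumes "exact_cochain p (subtopology X S) c" "T \<subseteq> S"
  shows "exact_cochain p (subtopology X T) c"
  using assms singular_chain_mono unfolding exact_cochain_def by blast

section \<open>Pullback of cochains along continuous maps\<close>

definition pullback :: "nat \<Rightarrow> ('a \<Rightarrow> 'b) \<Rightarrow> (((nat \<Rightarrow> real) \<Rightarrow> 'b) \<Rightarrow> int)
    \<Rightarrow> ((nat \<Rightarrow> real) \<Rightarrow> 'a) \<Rightarrow> int"
  where "pullback p f c = (\<lambda>s. c (simplex_map p f s))"

lemma ev_pullback: "ev (pullback p f c) z = ev c (chain_map p f z)"
  by (rule ev_unique[of z UNIV]) (auto simp: pullback_def chain_map_diff ev_diff)

lemma closed_cochain_pullback:
  assumes "closed_cochain p Y c" "continuous_map X Y f"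
  shows "closed_cochain p X (pullback p f c)"
  unfolding closed_cochain_def
proof (intro allI impI)
  fix z assume z: "singular_chain (Suc p) X z"
  then have "chain_map p f (chain_boundary (Suc p) z) = chain_boundary (Suc p) (chain_map (Suc p) f z)"
    by (simp add: chain_boundary_chain_map)
  then show "ev (pullback p f c) (chain_boundary (Suc p) z) = 0"
    using assms z by (simp add: ev_pullback closed_cochain_def singular_chain_chain_map)
qed

lemma exact_cochain_pullback:
  assumes "exact_cochain p Y c" "continuous_map X Y f"
  shows "exact_cochain p X (pullback p f c)"
proof -
  obtain e where e: "\<And>z. singular_chain p Y z \<Longrightarrow> ev c z = ev e (chain_boundary p z)"
    using assms(1) by (auto simp: exact_cochain_def)
  have "ev (pullback p f c) z = ev (pullback (p - Suc 0) f e) (chain_boundary p z)"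
    if "singular_chain p X z" for z
    using that e[OF singular_chain_chain_map[OF that assms(2)]]
    by (simp add: ev_pullback chain_boundary_chain_map)
  then show ?thesis
    unfolding exact_cochain_def by blast
qed

text \<open>There is one simplex in each dimension. Its boundary is zero in odd dimensions and the
  next lower simplex in even positive ones, so a closed cochain of odd degree is zero and one of
  even positive degree has a constant primitive.\<close>

lemma cohomology_vanishes_singleton:
  assumes "topspace X = {a}" "p > 0"
  shows "cohomology_vanishes p X"
  unfolding cohomology_vanishes_def
proof (intro allI impI)
  fix c :: "((nat \<Rightarrow> real) \<Rightarrow> 'a) \<Rightarrow> int"
  assume c: "closed_cochain p X c"
  define \<sigma> where "\<sigma> q = restrict (\<lambda>x. a) (standard_simplex q)" for q
  have simp: "singular_simplex q X (\<sigma> q)" for q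
    using assms(1) by (simp add: singular_simplex_singleton \<sigma>_def)
  have bd: "chain_boundary q (frag_of (\<sigma> q)) = (if q = 0 \<or> odd q then 0 else frag_of (\<sigma> (q - 1)))" for q
    using chain_boundary_of_singleton[OF assms(1), of q "frag_of (\<sigma> q)"] simp[of q]
    by (simp add: singular_chain_of \<sigma>_def)
  have "c (\<sigma> p) = (if odd p then 0 else c (\<sigma> p))"
  proof (cases "odd p")
    case True
    then show ?thesis
      using c simp[of "Suc p"] bd[of "Suc p"] unfolding closed_cochain_def
      by (metis diff_Suc_1 ev_of even_Suc nat.simps(3) singular_chain_of)
  qed simp
  then have "c (\<sigma> p) = ev (\<lambda>_. c (\<sigma> p)) (chain_boundary p (frag_of (\<sigma> p)))"
    using assms(2) by (auto simp: bd)
  then have "ev c z = ev (\<lambda>_. c (\<sigma> p)) (chain_boundary p z)" if "singular_chain p X z" for z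
    using that singular_chain_singleton[OF assms(1), of p z]
    by (auto simp: chain_boundary_cmul ev_cmul \<sigma>_def)
  then show "exact_cochain p X c"
    unfolding exact_cochain_def by blast
qed

text \<open>A homomorphism on chains is recovered from its values on simplices, and a primitive,
  restricted to chains, is again an element of the cochain group. So every cocycle is a coboundary
  and the quotient has a single coset.\<close>

theorem trivial_cohomology_group:
  assumes van: "cohomology_vanishes p X" and "p > 0"
  shows "trivial_group (cohomology_group p X integer_group)"
proof -
  have ab: "comm_group integer_group"
    by (rule abelian_integer_group)
  obtain q where q: "p = Suc q"
    using \<open>p > 0\<close> gr0_implies_Suc by blast
  have sub: "singular_cocycles p X integer_group \<subseteq> singular_coboundaries p X integer_group"
  proof
    fix \<phi> :: "'a chain \<Rightarrow> int"
    assume \<phi>: "\<phi> \<in> singular_cocycles p X integer_group"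
    then have hom: "\<phi> \<in> hom (chain_group p X) integer_group"
      and ext: "\<phi> \<in> extensional (singular_chain_set p X)"
      and cob: "coboundary p X \<phi> = \<one>\<^bsub>cochain_group (Suc p) X integer_group\<^esub>"
      by (auto simp: singular_cocycles_def kernel_def carrier_cochain_group)
    have add: "\<phi> (x + y) = \<phi> x + \<phi> y" if "singular_chain p X x" "singular_chain p X y" for x y
      using hom that by (auto simp: hom_def)
    define c where "c s = \<phi> (frag_of s)" for s
    have ev: "ev c z = \<phi> z" if "singular_chain p X z" for z
    proof -
      \<comment> \<open>Being a chain is carried through the induction because \<open>\<phi>\<close>
        is additive on singular chains only.\<close>
      have "singular_chain p X z \<and> ev c z = \<phi> z"
        using that[unfolded singular_chain_def]
      proof (induction z rule: frag_induction)
        case zero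
        then show ?case using add[of 0 0] by simp
      next
        case (one s)
        then show ?case by (simp add: c_def singular_chain_of)
      next
        case (diff a b)
        then have "\<phi> a = \<phi> (a - b) + \<phi> b"
          using add[of "a - b" b] by (simp add: singular_chain_diff)
        with diff show ?case
          by (simp add: ev_diff singular_chain_diff)
      qed
      then show ?thesis ..
    qed
    have "\<phi> (chain_boundary (Suc p) z) = 0" if "singular_chain (Suc p) X z" for z
      using fun_cong[OF cob, of z] that by (simp add: coboundary_def one_cochain_group)
    then have "closed_cochain p X c"
      by (simp add: closed_cochain_def ev singular_chain_boundary_alt)
    with van obtain e where e: "\<And>z. singular_chain p X z \<Longrightarrow> ev c z = ev e (chain_boundary p z)"
      by (auto simp: cohomology_vanishes_def exact_cochain_def)
    define \<psi> where "\<psi> = restrict (ev e) (singular_chain_set q X)"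
    have "\<psi> \<in> carrier (cochain_group q X integer_group)"
      by (auto simp: carrier_cochain_group hom_def \<psi>_def ev_add singular_chain_add)
    moreover have "coboundary q X \<psi> = \<phi>"
    proof
      fix z show "coboundary q X \<psi> z = \<phi> z"
        using e[of z] ev[of z] ext
        by (auto simp: coboundary_def \<psi>_def q singular_chain_boundary_alt extensional_def)
    qed
    ultimately show "\<phi> \<in> singular_coboundaries p X integer_group"
      by (auto simp: q)
  qed
  let ?C = "cocycle_group p X integer_group" and ?B = "singular_coboundaries p X integer_group"
  interpret N: normal ?B ?C
    by (rule normal_singular_coboundaries[OF ab])
  have B: "?B = carrier ?C"
    using sub N.subset by (auto simp: cocycle_group_def)
  have "rcosets\<^bsub>?C\<^esub> ?B = {?B}"
    using N.rcosets_part_G N.coset_join2[OF _ N.is_subgroup] N.one_closed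
    by (auto simp: RCOSETS_def B)
  then show ?thesis
    using group_cohomology_group[OF ab, of p X]
    by (simp add: trivial_group_def cohomology_group_def FactGroup_def)
qed

section \<open>Homotopy invariance\<close>

text \<open>The contraction makes the cycle homologous to its image in a single point, where every
  cycle of positive degree bounds.\<close>

lemma cycle_in_contractible_space:
  assumes X: "contractible_space X" and "q > 0"
    and z: "singular_chain q X z" "chain_boundary q z = 0"
  obtains d where "singular_chain (Suc q) X d" "chain_boundary (Suc q) d = z"
proof (cases "topspace X = {}")
  case True
  then have "z = 0"
    using z by (simp add: singular_chain_empty)
  then show ?thesis
    using that[of 0] by simp
next
  case False
  obtain a where hom: "homotopic_with (\<lambda>_. True) X X id (\<lambda>_. a)"
    using X by (auto simp: contractible_space_def)
  have a: "a \<in> topspace X"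
    using homotopic_with_imp_continuous_maps[OF hom] False by (auto simp: continuous_map_def)
  have cyc: "singular_relcycle q X {} z"
    using z by (simp add: singular_cycle)
  have "homologous_rel q X {} (chain_map q id z) (chain_map q (\<lambda>_. a) z)"
    by (rule homotopic_imp_homologous_rel_chain_maps[OF _ cyc]) (use hom in simp)
  then have rel: "homologous_rel q X {} z (chain_map q (\<lambda>_. a) z)"
    using z chain_map_ident[of q X z] by simp
  have "singular_relcycle q (subtopology X {a}) {} (chain_map q (\<lambda>_. a) z)"
    by (rule singular_relcycle_chain_map[OF cyc]) (use a in \<open>auto simp: continuous_map_in_subtopology\<close>)
  then have "singular_relboundary q (subtopology X {a}) {} (chain_map q (\<lambda>_. a) z)"
    using singular_boundary_eq_cycle_singleton[of "subtopology X {a}" a q] a \<open>q > 0\<close> by simp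
  then have "singular_relboundary q X {} (chain_map q (\<lambda>_. a) z)"
    using singular_boundary_mono[of "{a}" UNIV q X] by simp
  then have "singular_relboundary q X {} (z - chain_map q (\<lambda>_. a) z + chain_map q (\<lambda>_. a) z)"
    using rel unfolding homologous_rel_def by (rule singular_relboundary_add[rotated])
  then show ?thesis
    using that by (auto simp: singular_boundary)
qed

section \<open>The prism operator on the cylinder\<close>

abbreviation simplex_space :: "nat \<Rightarrow> (nat \<Rightarrow> real) topology"
  where "simplex_space q \<equiv> subtopology (powertop_real UNIV) (standard_simplex q)"

abbreviation cylinder_space :: "'a topology \<Rightarrow> (real \<times> 'a) topology"
  where "cylinder_space X \<equiv> prod_topology (top_of_set {0..1}) X"

abbreviation simplex_id :: "nat \<Rightarrow> (nat \<Rightarrow> real) chain"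
  where "simplex_id q \<equiv> frag_of (restrict id (standard_simplex q))"

lemma singular_chain_simplex_id: "singular_chain q (simplex_space q) (simplex_id q)"
  unfolding singular_chain_of singular_simplex_def
  by (auto intro: continuous_map_eq[of _ _ id])

lemma contractible_simplex_space: "contractible_space (simplex_space q)"
proof -
  define v where "v = (\<lambda>j::nat. if j = 0 then 1 else (0::real))"
  have v: "v \<in> standard_simplex q"
    by (simp add: v_def)
  have "homotopic_with (\<lambda>_. True) (simplex_space q) (simplex_space q) id (\<lambda>_. v)"
    unfolding homotopic_with_def
  proof (intro exI[of _ "\<lambda>(u, x) i. (1 - u) * x i + u * v i"] conjI)
    show "continuous_map (cylinder_space (simplex_space q)) (simplex_space q)
        (\<lambda>(u, x) i. (1 - u) * x i + u * v i)"
      unfolding continuous_map_in_subtopology continuous_map_componentwise_UNIV case_prod_unfold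
    proof (intro conjI allI)
      fix k
      have "continuous_map (cylinder_space (simplex_space q)) euclideanreal fst"
        using continuous_map_fst continuous_map_in_subtopology by blast
      moreover have "continuous_map (cylinder_space (simplex_space q)) euclideanreal ((\<lambda>x. x k) \<circ> snd)"
        by (rule continuous_map_compose[OF continuous_map_snd])
           (auto intro: continuous_map_from_subtopology continuous_map_product_projection)
      ultimately show "continuous_map (cylinder_space (simplex_space q)) euclideanreal
          (\<lambda>x. (1 - fst x) * snd x k + fst x * v k)"
        by (auto simp: o_def intro!: continuous_intros)
    next
      show "(\<lambda>x i. (1 - fst x) * snd x i + fst x * v i)
          \<in> topspace (cylinder_space (simplex_space q)) \<rightarrow> standard_simplex q"
        using v by (auto intro!: convex_standard_simplex)
    qed
  qed auto
  then show ?thesis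
    unfolding contractible_space_def by blast
qed

lemma contractible_cylinder_space: "contractible_space (cylinder_space (simplex_space q))"
proof -
  have "contractible {0..1 :: real}"
    by (intro convex_imp_contractible convex_real_interval)
  then show ?thesis
    unfolding contractible_space_prod_topology by (simp add: contractible_simplex_space del: contractible_space_subtopology_euclideanreal)
qed

text \<open>The natural operator generated by one model: \<open>y\<close> is a chain on the cylinder
  over the standard simplex, and each simplex \<open>\<sigma>\<close> of the argument transports it
  into the cylinder over the space.\<close>

definition cylinder_chain ::
    "nat \<Rightarrow> (real \<times> (nat \<Rightarrow> real)) chain \<Rightarrow> 'a chain \<Rightarrow> (real \<times> 'a) chain"
  where "cylinder_chain q y = frag_extend (\<lambda>\<sigma>. chain_map (Suc q) (map_prod id \<sigma>) y)"

lemma cylinder_chain_0 [simp]: "cylinder_chain q y 0 = 0"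
  by (simp add: cylinder_chain_def)

lemma cylinder_chain_diff: "cylinder_chain q y (a - b) = cylinder_chain q y a - cylinder_chain q y b"
  by (simp add: cylinder_chain_def frag_extend_diff)

lemma continuous_map_cylinder:
  assumes "singular_simplex q X \<sigma>"
  shows "continuous_map (cylinder_space (simplex_space q)) (cylinder_space X) (map_prod id \<sigma>)"
proof -
  have "continuous_map (simplex_space q) X \<sigma>"
    using assms by (simp add: singular_simplex_def)
  then have "continuous_map (cylinder_space (simplex_space q)) X (\<sigma> \<circ> snd)"
    using continuous_map_compose continuous_map_snd by blast
  then show ?thesis
    by (auto simp: continuous_map_pairwise o_def continuous_map_fst)
qed

lemma singular_chain_cylinder_chain:
  assumes y: "singular_chain (Suc q) (cylinder_space (simplex_space q)) y"
    and z: "singular_chain q X z"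
  shows "singular_chain (Suc q) (cylinder_space X) (cylinder_chain q y z)"
  unfolding cylinder_chain_def
proof (rule singular_chain_extend)
  fix \<sigma> assume "\<sigma> \<in> Poly_Mapping.keys z"
  then have "singular_simplex q X \<sigma>"
    using z by (auto simp: singular_chain_def)
  then show "singular_chain (Suc q) (cylinder_space X) (chain_map (Suc q) (map_prod id \<sigma>) y)"
    using continuous_map_cylinder singular_chain_chain_map[OF y] by blast
qed

text \<open>Naturality of the operator; this is what allows boundary formulas to be checked on the
  identity simplex alone.\<close>

lemma chain_map_cylinder_chain:
  assumes y: "singular_chain (Suc q) (cylinder_space (simplex_space q)) y"
    and z: "singular_chain q X z"
  shows "chain_map (Suc q) (map_prod id g) (cylinder_chain q y z)
       = cylinder_chain q y (chain_map q g z)"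
  using z unfolding singular_chain_def
proof (induction z rule: frag_induction)
  case (one \<tau>)
  have "chain_map (Suc q) (map_prod id g) (cylinder_chain q y (frag_of \<tau>))
      = chain_map (Suc q) (map_prod id g \<circ> map_prod id \<tau>) y"
    by (simp add: cylinder_chain_def chain_map_compose)
  also have "\<dots> = chain_map (Suc q) (map_prod id (simplex_map q g \<tau>)) y"
    by (rule chain_map_eq[OF y]) (auto simp: simplex_map_def)
  finally show ?case
    by (simp only: cylinder_chain_def chain_map_of frag_extend_of)
qed (auto simp: cylinder_chain_diff chain_map_diff)

definition cylinder_end :: "nat \<Rightarrow> 'a chain \<Rightarrow> (real \<times> 'a) chain"
  where "cylinder_end q z = chain_map q (Pair 1) z - chain_map q (Pair 0) z"

lemma cylinder_end_diff: "cylinder_end q (a - b) = cylinder_end q a - cylinder_end q b"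
  by (simp add: cylinder_end_def chain_map_diff)

lemma continuous_map_cylinder_end:
  "t \<in> {0..1} \<Longrightarrow> continuous_map X (cylinder_space X) (Pair t)"
  by (auto simp: continuous_map_pairwise o_def)

lemma singular_chain_cylinder_end:
  "singular_chain q X z \<Longrightarrow> singular_chain q (cylinder_space X) (cylinder_end q z)"
  unfolding cylinder_end_def
  by (intro singular_chain_diff) (auto intro!: singular_chain_chain_map continuous_map_cylinder_end)

lemma chain_boundary_cylinder_end:
  "singular_chain q X z \<Longrightarrow>
    chain_boundary q (cylinder_end q z) = cylinder_end (q - Suc 0) (chain_boundary q z)"
  unfolding cylinder_end_def by (simp add: chain_boundary_diff chain_boundary_chain_map)

text \<open>Every term is natural and every simplex is the image of the identity simplex, so the
  formula \<open>bd\<close> for the model carries over to all chains.\<close>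

lemma chain_boundary_cylinder_chain:
  assumes x: "q > 0 \<Longrightarrow> singular_chain q (cylinder_space (simplex_space (q - 1))) x"
    and y: "singular_chain (Suc q) (cylinder_space (simplex_space q)) y"
    and bd: "chain_boundary (Suc q) y =
      cylinder_end q (simplex_id q) - cylinder_chain (q - 1) x (chain_boundary q (simplex_id q))"
    and z: "singular_chain q X z"
  shows "chain_boundary (Suc q) (cylinder_chain q y z) =
      cylinder_end q z - cylinder_chain (q - 1) x (chain_boundary q z)"
  using z unfolding singular_chain_def
proof (induction z rule: frag_induction)
  case (one \<sigma>)
  then have \<sigma>: "singular_simplex q X \<sigma>"
    by simp
  have id\<sigma>: "chain_map q \<sigma> (simplex_id q) = frag_of \<sigma>"
    by (rule singular_simplex_chain_map_id[OF \<sigma>])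
  have 1: "chain_map q (map_prod id \<sigma>) (chain_map q (Pair t) (simplex_id q))
      = chain_map q (Pair t) (frag_of \<sigma>)" for t :: real
  proof -
    have "chain_map q (map_prod id \<sigma>) (chain_map q (Pair t) (simplex_id q))
        = chain_map q (Pair t \<circ> \<sigma>) (simplex_id q)"
      using fun_cong[OF chain_map_compose[of q "map_prod id \<sigma>" "Pair t"], of "simplex_id q"]
      by (simp only: comp_apply o_def map_prod_simp id_apply)
    then show ?thesis
      using id\<sigma> chain_map_compose[of q "Pair t" \<sigma>] by (simp only: comp_apply)
  qed
  have 2: "chain_map q (map_prod id \<sigma>) (cylinder_chain (q - 1) x (chain_boundary q (simplex_id q)))
      = cylinder_chain (q - 1) x (chain_boundary q (frag_of \<sigma>))"
  proof (cases "q = 0")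
    case False
    have "chain_map (q - 1) \<sigma> (chain_boundary q (simplex_id q)) = chain_boundary q (frag_of \<sigma>)"
      using chain_boundary_chain_map[OF singular_chain_simplex_id, of q \<sigma>] id\<sigma> by simp
    then show ?thesis
      using chain_map_cylinder_chain[of "q - 1" x "simplex_space q" "chain_boundary q (simplex_id q)" \<sigma>]
        x False singular_chain_boundary[OF singular_chain_simplex_id, of q]
      by simp
  qed (simp add: chain_boundary_def)
  have "chain_boundary (Suc q) (cylinder_chain q y (frag_of \<sigma>))
      = chain_map q (map_prod id \<sigma>) (chain_boundary (Suc q) y)"
    using chain_boundary_chain_map[OF y, of "map_prod id \<sigma>"] by (simp add: cylinder_chain_def)
  then show ?case
    unfolding bd cylinder_end_def by (simp only: chain_map_diff 1 2)
next
  case zero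
  show ?case
    by (simp add: cylinder_end_def)
qed (auto simp: cylinder_chain_diff chain_boundary_diff cylinder_end_diff)

text \<open>Acyclic models: the chains are built by filling in cycles of the contractible
  cylinders over standard simplices, one dimension at a time.\<close>

lemma prism_chains_exist:
  obtains y where
    "\<And>q. singular_chain (Suc q) (cylinder_space (simplex_space q)) (y q)"
    "\<And>q. chain_boundary (Suc q) (y q) = cylinder_end q (simplex_id q)
        - cylinder_chain (q - 1) (y (q - 1)) (chain_boundary q (simplex_id q))"
proof -
  let ?C = "\<lambda>q. cylinder_space (simplex_space q)"
  \<comment> \<open>\<open>P\<close> keeps the prism formula only on cycles, where the correction
    term drops out and which is all that the next dimension needs. It ranges over spaces of one
    type, the one in which the standard simplices live.\<close>
  define P where "P q y \<longleftrightarrow> singular_chain (Suc q) (?C q) y \<and>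
    (\<forall>(X :: (nat \<Rightarrow> real) topology) z. singular_chain q X z \<and> chain_boundary q z = 0 \<longrightarrow>
       chain_boundary (Suc q) (cylinder_chain q y z) = cylinder_end q z)" for q y
  define Q where "Q q x y \<longleftrightarrow> chain_boundary (Suc (Suc q)) y = cylinder_end (Suc q) (simplex_id (Suc q))
        - cylinder_chain q x (chain_boundary (Suc q) (simplex_id (Suc q)))" for q x y
  have P0: "chain_boundary (Suc 0) y = cylinder_end 0 (simplex_id 0) \<Longrightarrow>
      singular_chain (Suc 0) (?C 0) y \<Longrightarrow> P 0 y" for y
    unfolding P_def using chain_boundary_cylinder_chain[of 0 0 y, where 'a = "nat \<Rightarrow> real"]
    by (simp add: chain_boundary_def[of 0])
  \<comment> \<open>Filling requires positive degree, so dimension zero is treated apart: the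
    identity of the cylinder is a homotopy between its two ends, hence the difference of the end
    chains bounds.\<close>
  have base: "\<exists>y. P 0 y \<and> chain_boundary (Suc 0) y = cylinder_end 0 (simplex_id 0)"
  proof -
    have "homotopic_with (\<lambda>_. True) (simplex_space 0) (?C 0) (Pair 0) (Pair 1)"
      unfolding homotopic_with_def by (intro exI[of _ id]) auto
    then have "homologous_rel 0 (?C 0) {} (chain_map 0 (Pair 1) (simplex_id 0)) (chain_map 0 (Pair 0) (simplex_id 0))"
      using singular_chain_simplex_id[of 0]
      by (intro homotopic_imp_homologous_rel_chain_maps[where T = "{}" and S = "simplex_space 0"])
         (auto simp: homotopic_with_sym singular_cycle chain_boundary_def)
    then show ?thesis
      using P0 by (auto simp: homologous_rel_def singular_boundary cylinder_end_def)
  qed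
  have step: "\<exists>y. P (Suc q) y \<and> Q q x y" if "P q x" for q x
  proof -
    let ?i = "simplex_id (Suc q)"
    let ?r = "cylinder_end (Suc q) ?i - cylinder_chain q x (chain_boundary (Suc q) ?i)"
    have i: "singular_chain q (simplex_space (Suc q)) (chain_boundary (Suc q) ?i)"
      by (rule singular_chain_boundary_alt[OF singular_chain_simplex_id])
    have x: "singular_chain (Suc q) (?C q) x"
      using that by (simp add: P_def)
    \<comment> \<open>The boundary of the simplex is a cycle, so \<open>P q x\<close> applies to it;
      both parts of \<open>?r\<close> then have the same boundary, and \<open>?r\<close> is a cycle
      that can be filled.\<close>
    have "chain_boundary (Suc q) (cylinder_chain q x (chain_boundary (Suc q) ?i))
        = cylinder_end q (chain_boundary (Suc q) ?i)"
      using that i chain_boundary_boundary_alt[OF singular_chain_simplex_id] unfolding P_def by blast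
    then have "chain_boundary (Suc q) ?r = 0"
      using chain_boundary_cylinder_end[OF singular_chain_simplex_id, of "Suc q"]
      by (simp add: chain_boundary_diff)
    moreover have "singular_chain (Suc q) (?C (Suc q)) ?r"
      by (intro singular_chain_diff singular_chain_cylinder_end singular_chain_simplex_id
            singular_chain_cylinder_chain x i)
    ultimately obtain y where y: "singular_chain (Suc (Suc q)) (?C (Suc q)) y"
        "chain_boundary (Suc (Suc q)) y = ?r"
      using cycle_in_contractible_space[OF contractible_cylinder_space, of "Suc q" "Suc q" ?r] by blast
    have "P (Suc q) y"
      unfolding P_def
    proof (intro conjI allI impI y(1))
      fix X :: "(nat \<Rightarrow> real) topology" and z
      assume "singular_chain (Suc q) X z \<and> chain_boundary (Suc q) z = 0"
      then show "chain_boundary (Suc (Suc q)) (cylinder_chain (Suc q) y z) = cylinder_end (Suc q) z"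
        using chain_boundary_cylinder_chain[of "Suc q" x y X z] x y by simp
    qed
    with y show ?thesis
      by (auto simp: Q_def)
  qed
  have "\<exists>f. \<forall>q. (P q (f q) \<and> (q = 0 \<longrightarrow> chain_boundary (Suc 0) (f q) = cylinder_end 0 (simplex_id 0)))
      \<and> Q q (f q) (f (Suc q))"
    by (rule dependent_nat_choice) (use base step in blast)+
  then obtain f where f: "\<And>q. P q (f q)" "\<And>q. Q q (f q) (f (Suc q))"
      "chain_boundary (Suc 0) (f 0) = cylinder_end 0 (simplex_id 0)"
    by blast
  show ?thesis
  proof
    show "singular_chain (Suc q) (?C q) (f q)" for q
      using f(1) by (simp add: P_def)
    show "chain_boundary (Suc q) (f q) = cylinder_end q (simplex_id q)
        - cylinder_chain (q - 1) (f (q - 1)) (chain_boundary q (simplex_id q))" for q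
      using f(2)[of "q - 1"] f(3) by (cases q) (auto simp: Q_def chain_boundary_def[of 0])
  qed
qed

text \<open>The boundary of the prism \<open>K z\<close> is the image under \<open>g\<close> minus
  the image under \<open>f\<close> minus \<open>K\<close> of the boundary of \<open>z\<close>. A
  closed cochain kills the left side, so composing it with \<open>K\<close> gives a primitive of the
  difference.\<close>

theorem exact_cochain_homotopic:
  assumes hom: "homotopic_with (\<lambda>_. True) X Y f g" and c: "closed_cochain p Y c"
  shows "exact_cochain p X (\<lambda>s. pullback p g c s - pullback p f c s)"
proof -
  obtain h where conth: "continuous_map (cylinder_space X) Y h"
    and h: "\<And>x. h (0, x) = f x" "\<And>x. h (1, x) = g x"
    using hom by (auto simp: homotopic_with_def)
  obtain y where y: "\<And>q. singular_chain (Suc q) (cylinder_space (simplex_space q)) (y q)"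
    "\<And>q. chain_boundary (Suc q) (y q) = cylinder_end q (simplex_id q)
        - cylinder_chain (q - 1) (y (q - 1)) (chain_boundary q (simplex_id q))"
    using prism_chains_exist by blast
  define K where "K q z = chain_map (Suc q) h (cylinder_chain q (y q) z)" for q z
  have K_diff: "K q (a - b) = K q a - K q b" for q a b
    by (simp add: K_def cylinder_chain_diff chain_map_diff)
  define e where "e = (\<lambda>s. - ev c (K (p - 1) (frag_of s)))"
  have e: "ev e w = - ev c (K (p - 1) w)" for w
    by (rule ev_unique[of w UNIV]) (auto simp: e_def K_diff ev_diff)
  have "ev (\<lambda>s. pullback p g c s - pullback p f c s) z = ev (\<lambda>s. - e s) (chain_boundary p z)"
    if z: "singular_chain p X z" for z
  proof -
    have cyl: "singular_chain (Suc p) (cylinder_space X) (cylinder_chain p (y p) z)"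
      by (rule singular_chain_cylinder_chain[OF y(1) z])
    have "chain_map p h (chain_map p (Pair t) z) = chain_map p (\<lambda>x. h (t, x)) z" for t
      using fun_cong[OF chain_map_compose[of p h "Pair t"], of z] by (simp add: o_def)
    then have end_map: "chain_map p h (cylinder_end p z) = chain_map p g z - chain_map p f z"
      by (simp add: cylinder_end_def chain_map_diff h)
    have "chain_boundary (Suc p) (K p z)
        = chain_map p h (cylinder_end p z - cylinder_chain (p - 1) (y (p - 1)) (chain_boundary p z))"
      unfolding K_def using chain_boundary_chain_map[OF cyl, of h] y
        chain_boundary_cylinder_chain[of p "y (p - 1)" "y p" X z] z
      by (cases p) auto
    also have "\<dots> = chain_map p g z - chain_map p f z - K (p - 1) (chain_boundary p z)"
    proof -
      have "chain_map p h (cylinder_chain (p - 1) (y (p - 1)) (chain_boundary p z))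
          = K (p - 1) (chain_boundary p z)"
        by (cases p) (simp_all add: K_def chain_boundary_def[of 0])
      then show ?thesis
        by (simp only: chain_map_diff end_map)
    qed
    finally have "ev c (chain_map p g z - chain_map p f z - K (p - 1) (chain_boundary p z)) = 0"
      using c cyl conth singular_chain_chain_map by (metis K_def closed_cochain_def)
    then have "ev c (chain_map p g z) - ev c (chain_map p f z) = - ev e (chain_boundary p z)"
      by (simp add: ev_diff e)
    then show ?thesis
      using ev_cochain_diff[of "\<lambda>_. 0" e] by (simp add: ev_cochain_diff ev_pullback ev_cochain_0)
  qed
  then show ?thesis
    unfolding exact_cochain_def by blast
qed

lemma exact_cochain_pullback_homotopic_id:
  assumes "continuous_map X Y r" "continuous_map Y X s"
    and "homotopic_with (\<lambda>_. True) X X (s \<circ> r) id" and c: "closed_cochain p X c"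
  shows "exact_cochain p X (\<lambda>\<sigma>. c \<sigma> - pullback p r (pullback p s c) \<sigma>)"
proof (rule exact_cochain_cong[OF exact_cochain_homotopic[OF assms(3) c]])
  fix \<sigma> assume "singular_simplex p X \<sigma>"
  then show "pullback p id c \<sigma> - pullback p (s \<circ> r) c \<sigma> = c \<sigma> - pullback p r (pullback p s c) \<sigma>"
    by (simp add: pullback_def simplex_map_compose simplex_map_id_gen del: simplex_map_id)
qed

text \<open>A closed cochain on \<open>X\<close> differs by an exact one from its pullback along the
  round trip through \<open>Y\<close>, and that pullback is exact because it comes from
  \<open>Y\<close>.\<close>

lemma cohomology_vanishes_dominated:
  assumes "continuous_map X Y r" "continuous_map Y X s"
    and "homotopic_with (\<lambda>_. True) X X (s \<circ> r) id" and Y: "cohomology_vanishes p Y"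
  shows "cohomology_vanishes p X"
  unfolding cohomology_vanishes_def
proof (intro allI impI)
  fix c assume c: "closed_cochain p X c"
  have "exact_cochain p Y (pullback p s c)"
    using Y closed_cochain_pullback[OF c assms(2)] by (simp add: cohomology_vanishes_def)
  then have "exact_cochain p X (pullback p r (pullback p s c))"
    using assms(1) by (rule exact_cochain_pullback)
  from exact_cochain_add[OF exact_cochain_pullback_homotopic_id[OF assms(1-3) c] this]
  show "exact_cochain p X c"
    by simp
qed

section \<open>Small cochains and Mayer--Vietoris\<close>

definition small_chain :: "'a set set \<Rightarrow> nat \<Rightarrow> 'a topology \<Rightarrow> 'a chain \<Rightarrow> bool"
  where "small_chain \<C> p X z \<longleftrightarrow>
    Poly_Mapping.keys z \<subseteq> {s. \<exists>V\<in>\<C>. singular_simplex p (subtopology X V) s}"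

lemma small_chain_0 [simp]: "small_chain \<C> p X 0"
  by (simp add: small_chain_def)

lemma small_chain_diff: "small_chain \<C> p X a \<Longrightarrow> small_chain \<C> p X b \<Longrightarrow> small_chain \<C> p X (a - b)"
  unfolding small_chain_def using keys_diff[of a b] by (meson order_trans sup_least)

lemma small_chain_add: "small_chain \<C> p X a \<Longrightarrow> small_chain \<C> p X b \<Longrightarrow> small_chain \<C> p X (a + b)"
  unfolding small_chain_def using keys_add[of a b] by (meson order_trans sup_least)

lemma small_chain_sum: "(\<And>i. i \<in> I \<Longrightarrow> small_chain \<C> p X (f i)) \<Longrightarrow> small_chain \<C> p X (sum f I)"
  by (induction I rule: infinite_finite_induct) (auto intro: small_chain_add)

lemma singular_chain_imp_small_chain:
  "singular_chain p (subtopology X V) z \<Longrightarrow> V \<in> \<C> \<Longrightarrow> small_chain \<C> p X z"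
  by (auto simp: small_chain_def singular_chain_def)

lemma small_chain_of:
  "small_chain \<C> p X (frag_of s) \<longleftrightarrow> (\<exists>V\<in>\<C>. singular_simplex p (subtopology X V) s)"
  by (auto simp: small_chain_def)

lemma small_chain_image:
  assumes "small_chain \<C> p X z" "\<And>x y. F (x - y) = F x - F y"
    and "\<And>V z. singular_chain p (subtopology X V) z \<Longrightarrow> singular_chain q (subtopology X V) (F z)"
  shows "small_chain \<C> q X (F z)"
  using assms(1) unfolding small_chain_def[of \<C> p]
proof (induction z rule: frag_induction)
  case zero
  then show ?case using assms(2)[of 0 0] by simp
next
  case (one s)
  then obtain V where V: "V \<in> \<C>" "singular_simplex p (subtopology X V) s"
    by auto
  then have "singular_chain q (subtopology X V) (F (frag_of s))"
    by (intro assms(3)) (simp add: singular_chain_of)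
  then show ?case
    using V(1) by (rule singular_chain_imp_small_chain)
qed (auto simp: assms(2) small_chain_diff)

lemma small_chain_boundary:
  "small_chain \<C> (Suc p) X z \<Longrightarrow> small_chain \<C> p X (chain_boundary (Suc p) z)"
  by (erule small_chain_image) (auto simp: chain_boundary_diff singular_chain_boundary_alt)

text \<open>The number of subdivisions depends on the simplex, so the operator \<open>T\<close> adds up the
  subdivision homotopies separately on each simplex.\<close>

lemma small_chain_operator_exists:
  fixes X :: "'a topology"
  assumes open\<C>: "\<And>U. U \<in> \<C> \<Longrightarrow> openin X U" and cover: "topspace X \<subseteq> \<Union>\<C>"
  obtains T :: "nat \<Rightarrow> 'a chain \<Rightarrow> 'a chain" where
    "\<And>p x y. T p (x - y) = T p x - T p y"
    "\<And>p z. singular_chain p X z \<Longrightarrow> singular_chain (Suc p) X (T p z)"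
    "\<And>p z. small_chain \<C> p X z \<Longrightarrow> T p z = 0"
    "\<And>p z. singular_chain p X z \<Longrightarrow>
       small_chain \<C> p X (z + chain_boundary (Suc p) (T p z) + T (p - 1) (chain_boundary p z))"
proof -
  obtain h where h0: "\<And>p. h p 0 = (0 :: 'a chain)"
    and hdiff: "\<And>p (c1 :: 'a chain) c2. h p (c1 - c2) = h p c1 - h p c2"
    and hchain: "\<And>p X (c :: 'a chain). singular_chain p X c \<Longrightarrow> singular_chain (Suc p) X (h p c)"
    and hbd: "\<And>p X (c :: 'a chain). singular_chain p X c \<Longrightarrow>
      chain_boundary (Suc p) (h p c) + h (p - Suc 0) (chain_boundary p c) = singular_subdivision p c - c"
    using chain_homotopic_singular_subdivision by blast
  let ?sd = "\<lambda>p m. (singular_subdivision p ^^ m) :: 'a chain \<Rightarrow> 'a chain"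
  have sd_chain: "singular_chain p Y (?sd p m z)" if "singular_chain p Y z" for p m z and Y :: "'a topology"
    by (induction m) (auto simp: that singular_chain_singular_subdivision)
  have sd_bd: "chain_boundary p (?sd p m z) = ?sd (p - Suc 0) m (chain_boundary p z)"
    if "singular_chain p X z" for p m z
    by (induction m) (auto simp: chain_boundary_singular_subdivision[OF sd_chain[OF that]])
  \<comment> \<open>Summing the one-step homotopies telescopes to a homotopy between the identity
    and \<open>m\<close>-fold subdivision.\<close>
  define H where "H m p z = (\<Sum>i<m. h p (?sd p i z))" for m p z
  have H_diff: "H m p (x - y) = H m p x - H m p y" for m p x y
    by (simp add: H_def singular_subdivision_power_diff hdiff sum_subtractf)
  have H_0: "H m p 0 = 0" for m p
    by (simp add: H_def h0)
  have H_bd: "z + chain_boundary (Suc p) (H m p z) + H m (p - 1) (chain_boundary p z) = ?sd p m z"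
    if z: "singular_chain p X z" for m p z
  proof (induction m)
    case (Suc m)
    have "?sd p (Suc m) z = ?sd p m z + (chain_boundary (Suc p) (h p (?sd p m z))
        + h (p - 1) (?sd (p - 1) m (chain_boundary p z)))"
      using hbd[OF sd_chain[OF z, of m]] sd_bd[OF z, of m] by simp
    moreover have "z + chain_boundary (Suc p) (H (Suc m) p z) + H (Suc m) (p - 1) (chain_boundary p z)
        = (z + chain_boundary (Suc p) (H m p z) + H m (p - 1) (chain_boundary p z))
          + (chain_boundary (Suc p) (h p (?sd p m z)) + h (p - 1) (?sd (p - 1) m (chain_boundary p z)))"
      by (simp add: H_def chain_boundary_add algebra_simps)
    ultimately show ?case
      by (simp only: Suc)
  qed (simp add: H_def)
  have sd_small: "small_chain \<C> p X (?sd p m z)" if "small_chain \<C> p X z" for p m z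
    using that by (rule small_chain_image) (auto simp: singular_subdivision_power_diff sd_chain)
  have h_small: "small_chain \<C> (Suc p) X (h p z)" if "small_chain \<C> p X z" for p z
    using that by (rule small_chain_image) (auto simp: hdiff hchain)
  have ev_small: "\<forall>\<^sub>F m in sequentially. small_chain \<C> p X (?sd p m z)"
    if z: "singular_chain p X z" for p z
  proof -
    obtain n where n: "\<And>m f. \<lbrakk>n \<le> m; f \<in> Poly_Mapping.keys (?sd p m z)\<rbrakk> \<Longrightarrow>
        \<exists>V\<in>\<C>. f \<in> standard_simplex p \<rightarrow> V"
      using sufficient_iterated_singular_subdivision_exists[OF open\<C> cover z] by metis
    have "small_chain \<C> p X (?sd p m z)" if "n \<le> m" for m
      unfolding small_chain_def
    proof
      fix f assume f: "f \<in> Poly_Mapping.keys (?sd p m z)"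
      then have "singular_simplex p X f"
        using sd_chain[OF z, of m] by (auto simp: singular_chain_def)
      then show "f \<in> {s. \<exists>V\<in>\<C>. singular_simplex p (subtopology X V) s}"
        using n[OF that f] by (auto simp: singular_simplex_subtopology)
    qed
    then show ?thesis
      unfolding eventually_sequentially by blast
  qed
  \<comment> \<open>Quantifying over all later subdivisions makes every tail of the sum defining
    \<open>H\<close> small; taking the least such number gives 0 on simplices that are small
    already, so that \<open>T\<close> vanishes there.\<close>
  define m where "m p s = (LEAST m. \<forall>j\<ge>m. small_chain \<C> p X (?sd p j (frag_of s)))" for p s
  have m: "small_chain \<C> p X (?sd p j (frag_of s))" if "singular_simplex p X s" "j \<ge> m p s" for p s j
  proof -
    have "\<exists>m. \<forall>j\<ge>m. small_chain \<C> p X (?sd p j (frag_of s))"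
      using ev_small[of p "frag_of s"] that(1) by (simp add: singular_chain_of eventually_sequentially)
    then have "\<forall>j\<ge>m p s. small_chain \<C> p X (?sd p j (frag_of s))"
      unfolding m_def by (rule LeastI_ex)
    then show ?thesis
      using that(2) by simp
  qed
  define T where "T p = frag_extend (\<lambda>s. H (m p s) p (frag_of s))" for p
  have T_diff: "T p (x - y) = T p x - T p y" for p x y
    by (simp add: T_def frag_extend_diff)
  have T_chain: "singular_chain (Suc p) X (T p z)" if "singular_chain p X z" for p z
    unfolding T_def
    by (rule singular_chain_extend)
       (use that in \<open>auto simp: H_def singular_chain_def[of p] singular_chain_of
                          intro!: singular_chain_sum hchain sd_chain\<close>)
  have T_small: "T p z = 0" if "small_chain \<C> p X z" for p z
    unfolding T_def
  proof (rule frag_extend_eq_0)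
    fix s assume "s \<in> Poly_Mapping.keys z"
    then have "small_chain \<C> p X (frag_of s)"
      using that by (auto simp: small_chain_def)
    then have "m p s = 0"
      unfolding m_def by (intro Least_eq_0) (auto intro: sd_small)
    then show "H (m p s) p (frag_of s) = 0"
      by (simp add: H_def)
  qed
  \<comment> \<open>On a fixed chain the simplexwise operator \<open>T\<close> agrees, up to small
    chains, with the uniform \<open>H k\<close> for large \<open>k\<close>. Smallness of the
    \<open>k\<close>-fold subdivision therefore passes to the expression in
    \<open>T\<close>.\<close>
  have H_T: "\<forall>\<^sub>F k in sequentially. small_chain \<C> (Suc p) X (H k p z - T p z)"
    if "singular_chain p X z" for p z
    using that unfolding singular_chain_def
  proof (induction z rule: frag_induction)
    case zero
    show ?case by (simp add: H_0 T_def)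
  next
    case (one s)
    then have s: "singular_simplex p X s"
      by simp
    have "small_chain \<C> (Suc p) X (H k p (frag_of s) - T p (frag_of s))" if "k \<ge> m p s" for k
    proof -
      have "{..<k} = {..<m p s} \<union> {m p s..<k}" "{..<m p s} \<inter> {m p s..<k} = {}"
        using that by auto
      then have "H k p (frag_of s) - T p (frag_of s) = (\<Sum>i=m p s..<k. h p (?sd p i (frag_of s)))"
        by (simp add: H_def T_def sum.union_disjoint)
      then show ?thesis
        by (auto intro!: small_chain_sum h_small m s)
    qed
    then show ?case
      unfolding eventually_sequentially by blast
  next
    case (diff a b)
    have eq: "H k p (a - b) - T p (a - b) = (H k p a - T p a) - (H k p b - T p b)" for k
      by (simp add: H_diff T_diff)
    show ?case
      unfolding eq using diff by eventually_elim (rule small_chain_diff)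
  qed
  have T_bd: "small_chain \<C> p X (z + chain_boundary (Suc p) (T p z) + T (p - 1) (chain_boundary p z))"
    if z: "singular_chain p X z" for p z
  proof -
    have "\<forall>\<^sub>F k in sequentially. small_chain \<C> p X (H k (p - 1) (chain_boundary p z) - T (p - 1) (chain_boundary p z))"
    proof (cases p)
      case 0
      then show ?thesis
        by (simp add: chain_boundary_def H_0 T_def)
    next
      case (Suc q)
      then show ?thesis
        using H_T[of q "chain_boundary p z"] z singular_chain_boundary_alt by auto
    qed
    then have "\<forall>\<^sub>F k in sequentially. small_chain \<C> p X (?sd p k z)
        \<and> small_chain \<C> (Suc p) X (H k p z - T p z)
        \<and> small_chain \<C> p X (H k (p - 1) (chain_boundary p z) - T (p - 1) (chain_boundary p z))"
      using ev_small[OF z] H_T[OF z] by eventually_elim simp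
    then obtain k where k: "small_chain \<C> p X (?sd p k z)"
        "small_chain \<C> (Suc p) X (H k p z - T p z)"
        "small_chain \<C> p X (H k (p - 1) (chain_boundary p z) - T (p - 1) (chain_boundary p z))"
      by (auto simp: eventually_sequentially)
    have "z + chain_boundary (Suc p) (T p z) + T (p - 1) (chain_boundary p z)
        = ?sd p k z - chain_boundary (Suc p) (H k p z - T p z)
          - (H k (p - 1) (chain_boundary p z) - T (p - 1) (chain_boundary p z))"
      unfolding H_bd[OF z, of k, symmetric] by (simp add: chain_boundary_diff)
    then show ?thesis
      using k by (simp only: small_chain_diff small_chain_boundary)
  qed
  show ?thesis
    using that[OF T_diff T_chain T_small T_bd] .
qed

text \<open>The operator \<open>R\<close>, identity plus boundary of \<open>T\<close> plus
  \<open>T\<close> of boundary, is a chain map into small chains and the identity on them. Composing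
  \<open>c\<close> with it gives a closed cochain with the same values on small chains.\<close>

lemma closed_cochain_extend_small:
  fixes X :: "'a topology"
  assumes open\<C>: "\<And>U. U \<in> \<C> \<Longrightarrow> openin X U" and cover: "topspace X \<subseteq> \<Union>\<C>"
    and c: "\<And>z. small_chain \<C> (Suc p) X z \<Longrightarrow> ev c (chain_boundary (Suc p) z) = 0"
  obtains d where "closed_cochain p X d" "\<And>z. small_chain \<C> p X z \<Longrightarrow> ev d z = ev c z"
proof -
  obtain T :: "nat \<Rightarrow> 'a chain \<Rightarrow> 'a chain" where
    T: "\<And>p x y. T p (x - y) = T p x - T p y"
    "\<And>p z. singular_chain p X z \<Longrightarrow> singular_chain (Suc p) X (T p z)"
    "\<And>p z. small_chain \<C> p X z \<Longrightarrow> T p z = 0"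
    "\<And>p z. singular_chain p X z \<Longrightarrow>
       small_chain \<C> p X (z + chain_boundary (Suc p) (T p z) + T (p - 1) (chain_boundary p z))"
    using small_chain_operator_exists[OF open\<C> cover] by blast
  have T0: "T q 0 = 0" for q
    by (rule T(3)) simp
  define R where "R q z = z + chain_boundary (Suc q) (T q z) + T (q - 1) (chain_boundary q z)" for q z
  have R_diff: "R q (x - y) = R q x - R q y" for q x y
    by (simp add: R_def T(1) chain_boundary_diff)
  have R_bd: "R p (chain_boundary (Suc p) z) = chain_boundary (Suc p) (R (Suc p) z)"
    if "singular_chain (Suc p) X z" for z
    using that T(2)[OF that]
    by (simp add: R_def chain_boundary_add chain_boundary_boundary_alt T0)
  define d where "d = (\<lambda>s. ev c (R p (frag_of s)))"
  have d: "ev d z = ev c (R p z)" for z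
    unfolding d_def by (rule ev_compose) (rule R_diff)
  show ?thesis
  proof
    show "closed_cochain p X d"
      unfolding closed_cochain_def d using R_bd c T(4)[of "Suc p"] by (simp add: R_def[of "Suc p"])
    show "ev d z = ev c z" if z: "small_chain \<C> p X z" for z
    proof -
      have "T (p - 1) (chain_boundary p z) = 0"
        using z T(3)[OF small_chain_boundary, of "p - 1" z]
        by (cases p) (auto simp: chain_boundary_def[of 0] T0)
      then show ?thesis
        using T(3)[OF z] by (simp add: d R_def)
    qed
  qed
qed

text \<open>For closed \<open>c\<close>, the value on \<open>z\<close> is the value on the small
  chain \<open>?R\<close> minus that on \<open>T\<close> of the boundary of \<open>z\<close>. The
  former is \<open>g\<close> on the boundary of \<open>?R\<close>, so both depend on the boundary of
  \<open>z\<close> only; \<open>F\<close> is this dependence.\<close>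

lemma exact_cochain_if_small_exact:
  fixes X :: "'a topology"
  assumes open\<C>: "\<And>U. U \<in> \<C> \<Longrightarrow> openin X U" and cover: "topspace X \<subseteq> \<Union>\<C>"
    and c: "closed_cochain p X c"
    and g: "\<And>z. small_chain \<C> p X z \<Longrightarrow> ev c z = ev g (chain_boundary p z)"
  shows "exact_cochain p X c"
proof -
  obtain T :: "nat \<Rightarrow> 'a chain \<Rightarrow> 'a chain" where
    T: "\<And>p x y. T p (x - y) = T p x - T p y"
    "\<And>p z. singular_chain p X z \<Longrightarrow> singular_chain (Suc p) X (T p z)"
    "\<And>p z. small_chain \<C> p X z \<Longrightarrow> T p z = 0"
    "\<And>p z. singular_chain p X z \<Longrightarrow>
       small_chain \<C> p X (z + chain_boundary (Suc p) (T p z) + T (p - 1) (chain_boundary p z))"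
    using small_chain_operator_exists[OF open\<C> cover] by blast
  have T0: "T q 0 = 0" for q
    by (rule T(3)) simp
  define F where "F w = ev g (w + chain_boundary p (T (p - 1) w)) - ev c (T (p - 1) w)" for w
  have F_diff: "F (x - y) = F x - F y" for x y
    by (simp add: F_def T(1) chain_boundary_diff ev_diff ev_add)
  have F: "ev (\<lambda>s. F (frag_of s)) w = F w" for w
    by (rule ev_unique[of w UNIV]) (auto simp: F_diff)
  have "ev c z = F (chain_boundary p z)" if z: "singular_chain p X z" for z
  proof -
    let ?R = "z + chain_boundary (Suc p) (T p z) + T (p - 1) (chain_boundary p z)"
    have "ev c (chain_boundary (Suc p) (T p z)) = 0"
      using c T(2)[OF z] by (simp add: closed_cochain_def)
    moreover have "ev c ?R = ev g (chain_boundary p ?R)"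
      using T(4)[OF z] by (rule g)
    moreover have "chain_boundary p ?R = chain_boundary p z + chain_boundary p (T (p - 1) (chain_boundary p z))"
      using chain_boundary_boundary_alt[OF T(2)[OF z]] by (simp add: chain_boundary_add)
    ultimately show ?thesis
      by (simp add: F_def ev_add)
  qed
  then show ?thesis
    unfolding exact_cochain_def by (intro exI[of _ "\<lambda>s. F (frag_of s)"]) (simp add: F)
qed

section \<open>Gluing cochains along families of disjoint open sets\<close>

lemma singular_simplex_in_unique:
  assumes "disjoint_family_on U I" "i \<in> I" "j \<in> I"
    and "singular_simplex p (subtopology X (U i)) s" "singular_simplex p (subtopology X (U j)) s"
  shows "i = j"
proof (rule ccontr)
  assume "i \<noteq> j"
  then have "U i \<inter> U j = {}"
    using assms(1-3) by (auto simp: disjoint_family_on_def)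
  then show False
    using assms(4,5) nonempty_standard_simplex[of p] by (auto simp: singular_simplex_subtopology)
qed

text \<open>A simplex is nonempty, so it lies in at most one \<open>U i\<close> and at most one
  \<open>V j\<close>. Values can thus be prescribed simplex by simplex, the only possible conflict
  being on the overlaps.\<close>

lemma glue_cochains:
  assumes U: "disjoint_family_on U I" and V: "disjoint_family_on V J"
    and agree: "\<And>i j s. i \<in> I \<Longrightarrow> j \<in> J \<Longrightarrow> singular_simplex p (subtopology X (U i \<inter> V j)) s \<Longrightarrow>
      a i s = b j s"
  obtains c where "\<And>i s. i \<in> I \<Longrightarrow> singular_simplex p (subtopology X (U i)) s \<Longrightarrow> c s = a i s"
    "\<And>j s. j \<in> J \<Longrightarrow> singular_simplex p (subtopology X (V j)) s \<Longrightarrow> c s = b j s"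
proof
  let ?P = "\<lambda>s i. i \<in> I \<and> singular_simplex p (subtopology X (U i)) s"
  let ?Q = "\<lambda>s j. j \<in> J \<and> singular_simplex p (subtopology X (V j)) s"
  define c where "c s = (if \<exists>i. ?P s i then a (THE i. ?P s i) s else b (THE j. ?Q s j) s)" for s
  show a: "c s = a i s" if "i \<in> I" "singular_simplex p (subtopology X (U i)) s" for i s
  proof -
    have "(THE i. ?P s i) = i"
      using that singular_simplex_in_unique[OF U] by (intro the_equality) blast+
    then show ?thesis
      using that by (auto simp: c_def)
  qed
  show "c s = b j s" if "j \<in> J" "singular_simplex p (subtopology X (V j)) s" for j s
  proof (cases "\<exists>i. ?P s i")
    case True
    then obtain i where i: "?P s i" ..
    then have "a i s = b j s"
      using that by (intro agree) (auto simp: singular_simplex_subtopology)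
    with i a[of i s] show ?thesis
      by simp
  next
    case False
    have "(THE j. ?Q s j) = j"
      using that singular_simplex_in_unique[OF V] by (intro the_equality) blast+
    with False show ?thesis
      by (simp only: c_def if_False)
  qed
qed

lemma glue_disjoint_cochains:
  assumes "disjoint_family_on U I"
  shows "\<exists>c. \<forall>i s. i \<in> I \<longrightarrow> singular_simplex p (subtopology X (U i)) s \<longrightarrow> c s = a i s"
proof -
  obtain c where "\<And>i s. i \<in> I \<Longrightarrow> singular_simplex p (subtopology X (U i)) s \<Longrightarrow> c s = a i s"
    using glue_cochains[OF assms, of "\<lambda>_. {}" "{}" p X a "\<lambda>_ _. undefined"]
    by (auto simp: disjoint_family_on_def)
  then show ?thesis
    by blast
qed

lemma ev_small_chain_eqI:
  assumes "small_chain (U ` I \<union> V ` J) p X z"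
    and "\<And>x y. f (x - y) = (f x - f y :: int)" "\<And>x y. g (x - y) = (g x - g y :: int)"
    and "\<And>i z. i \<in> I \<Longrightarrow> singular_chain p (subtopology X (U i)) z \<Longrightarrow> f z = g z"
    and "\<And>j z. j \<in> J \<Longrightarrow> singular_chain p (subtopology X (V j)) z \<Longrightarrow> f z = g z"
  shows "f z = g z"
  using assms(1) unfolding small_chain_def
proof (induction z rule: frag_induction)
  case zero
  then show ?case using assms(2,3)[of 0 0] by simp
next
  case (one s)
  then show ?case using assms(4,5)[of _ "frag_of s"] by (auto simp: singular_chain_of)
qed (simp add: assms(2,3))

text \<open>A cover by two families of pairwise disjoint sets behaves like a cover by two sets:
  it replaces Mayer--Vietoris together with the additivity of cohomology.\<close>

theorem closed_cochain_glue:
  assumes U: "\<And>i. i \<in> I \<Longrightarrow> openin X (U i)" "disjoint_family_on U I"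
    and V: "\<And>j. j \<in> J \<Longrightarrow> openin X (V j)" "disjoint_family_on V J"
    and cover: "topspace X \<subseteq> \<Union>(U ` I) \<union> \<Union>(V ` J)"
    and u: "\<And>i. i \<in> I \<Longrightarrow> closed_cochain p (subtopology X (U i)) (u i)"
    and ex: "\<And>i j. i \<in> I \<Longrightarrow> j \<in> J \<Longrightarrow> exact_cochain p (subtopology X (U i \<inter> V j)) (u i)"
  obtains c where "closed_cochain p X c"
    "\<And>i s. i \<in> I \<Longrightarrow> singular_simplex p (subtopology X (U i)) s \<Longrightarrow> c s = u i s"
proof -
  have "\<forall>i j. \<exists>e. i \<in> I \<and> j \<in> J \<longrightarrow> (\<forall>z. singular_chain p (subtopology X (U i \<inter> V j)) z \<longrightarrow>
      ev (u i) z = ev e (chain_boundary p z))"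
    using ex unfolding exact_cochain_def by blast
  then obtain e where e: "\<And>i j z. i \<in> I \<Longrightarrow> j \<in> J \<Longrightarrow>
      singular_chain p (subtopology X (U i \<inter> V j)) z \<Longrightarrow> ev (u i) z = ev (e i j) (chain_boundary p z)"
    by metis
  \<comment> \<open>For fixed \<open>j\<close> the primitives on the overlaps live over disjoint
    sets \<open>U i\<close>, so they combine into one cochain \<open>E j\<close>.\<close>
  have "\<forall>j. \<exists>E. \<forall>i s. i \<in> I \<longrightarrow> singular_simplex (p - 1) (subtopology X (U i)) s \<longrightarrow> E s = e i j s"
    by (intro allI glue_disjoint_cochains[OF U(2), where a = "\<lambda>i. e i j" for j])
  then obtain E where E: "\<And>i j s. i \<in> I \<Longrightarrow> singular_simplex (p - 1) (subtopology X (U i)) s \<Longrightarrow>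
      E j s = e i j s"
    by metis
  \<comment> \<open>A coboundary is closed wherever it is considered: that of \<open>E j\<close> is
    defined on all of \<open>V j\<close> and equals \<open>u i\<close> on the overlaps, so it
    continues the given cochains.\<close>
  define b where "b j s = ev (E j) (chain_boundary p (frag_of s))" for j s
  have ev_b: "ev (b j) z = ev (E j) (chain_boundary p z)" for j z
    unfolding b_def by (rule ev_compose) (rule chain_boundary_diff)
  have agree: "u i s = b j s"
    if "i \<in> I" "j \<in> J" "singular_simplex p (subtopology X (U i \<inter> V j)) s" for i j s
  proof -
    have "singular_chain p (subtopology X (U i)) (frag_of s)"
      using that(3) by (auto simp: singular_chain_of singular_simplex_subtopology)
    then have "singular_chain (p - 1) (subtopology X (U i)) (chain_boundary p (frag_of s))"
      using singular_chain_boundary by simp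
    then have "ev (E j) (chain_boundary p (frag_of s)) = ev (e i j) (chain_boundary p (frag_of s))"
      using E[OF that(1)] by (rule ev_eq_on_chain)
    then show ?thesis
      using e[OF that(1,2), of "frag_of s"] that(3) by (simp add: b_def singular_chain_of)
  qed
  obtain c where c: "\<And>i s. i \<in> I \<Longrightarrow> singular_simplex p (subtopology X (U i)) s \<Longrightarrow> c s = u i s"
    "\<And>j s. j \<in> J \<Longrightarrow> singular_simplex p (subtopology X (V j)) s \<Longrightarrow> c s = b j s"
    by (rule glue_cochains[OF U(2) V(2), of p X u b]) (use agree in auto)
  have small: "ev c (chain_boundary (Suc p) z) = 0"
    if "small_chain (U ` I \<union> V ` J) (Suc p) X z" for z
    using that
  proof (rule ev_small_chain_eqI[where g = "\<lambda>_. 0"])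
    fix i and z :: "'b chain"
    assume i: "i \<in> I" and z: "singular_chain (Suc p) (subtopology X (U i)) z"
    have "ev c (chain_boundary (Suc p) z) = ev (u i) (chain_boundary (Suc p) z)"
      using singular_chain_boundary_alt[OF z] c(1)[OF i] by (rule ev_eq_on_chain)
    then show "ev c (chain_boundary (Suc p) z) = 0"
      using u[OF i] z by (simp add: closed_cochain_def)
  next
    fix j and z :: "'b chain"
    assume j: "j \<in> J" and z: "singular_chain (Suc p) (subtopology X (V j)) z"
    have "ev c (chain_boundary (Suc p) z) = ev (b j) (chain_boundary (Suc p) z)"
      using singular_chain_boundary_alt[OF z] c(2)[OF j] by (rule ev_eq_on_chain)
    then show "ev c (chain_boundary (Suc p) z) = 0"
      by (simp add: ev_b chain_boundary_boundary_alt[OF z])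
  qed (auto simp: ev_diff chain_boundary_diff)
  \<comment> \<open>The glued \<open>c\<close> is closed on small chains only; \<open>d\<close> is
    closed on all chains and keeps its values on the simplices of the cover.\<close>
  obtain d where d: "closed_cochain p X d" "\<And>z. small_chain (U ` I \<union> V ` J) p X z \<Longrightarrow> ev d z = ev c z"
    by (rule closed_cochain_extend_small[where \<C> = "U ` I \<union> V ` J" and X = X and c = c, OF _ _ small])
       (use U(1) V(1) cover in auto)
  show ?thesis
  proof (rule that[OF d(1)])
    fix i s assume "i \<in> I" "singular_simplex p (subtopology X (U i)) s"
    then show "d s = u i s"
      using d(2)[of "frag_of s"] c(1) by (auto simp: small_chain_of)
  qed
qed

text \<open>Local primitives \<open>a i\<close> and \<open>b j\<close> differ on the overlaps by
  closed cochains. By \<open>surj\<close> these classes come from the sets \<open>U i\<close>, so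
  subtracting a closed correction from \<open>a i\<close> removes the obstruction to gluing. Since
  the \<open>U i\<close> are disjoint, \<open>surj\<close> is stated for one \<open>i\<close> at a
  time, but for all \<open>j\<close> simultaneously.\<close>

theorem cohomology_vanishes_cover:
  assumes U: "\<And>i. i \<in> I \<Longrightarrow> openin X (U i)" "disjoint_family_on U I"
    and V: "\<And>j. j \<in> J \<Longrightarrow> openin X (V j)" "disjoint_family_on V J"
    and cover: "topspace X \<subseteq> \<Union>(U ` I) \<union> \<Union>(V ` J)"
    and vanU: "\<And>i. i \<in> I \<Longrightarrow> cohomology_vanishes (Suc p) (subtopology X (U i))"
    and vanV: "\<And>j. j \<in> J \<Longrightarrow> cohomology_vanishes (Suc p) (subtopology X (V j))"
    and surj: "\<And>w i. i \<in> I \<Longrightarrow> (\<And>j. j \<in> J \<Longrightarrow> closed_cochain p (subtopology X (U i \<inter> V j)) (w j)) \<Longrightarrow>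
      \<exists>a. closed_cochain p (subtopology X (U i)) a \<and>
        (\<forall>j\<in>J. exact_cochain p (subtopology X (U i \<inter> V j)) (\<lambda>s. w j s - a s))"
  shows "cohomology_vanishes (Suc p) X"
  unfolding cohomology_vanishes_def
proof (intro allI impI)
  fix c assume c: "closed_cochain (Suc p) X c"
  have cS: "closed_cochain (Suc p) (subtopology X S) c" for S
    using closed_cochain_subtopology[of "Suc p" X UNIV] c by simp
  have "\<forall>i. \<exists>a. i \<in> I \<longrightarrow> (\<forall>z. singular_chain (Suc p) (subtopology X (U i)) z \<longrightarrow>
      ev c z = ev a (chain_boundary (Suc p) z))"
    using vanU cS unfolding cohomology_vanishes_def exact_cochain_def by blast
  then obtain a where a: "\<And>i z. i \<in> I \<Longrightarrow> singular_chain (Suc p) (subtopology X (U i)) z \<Longrightarrow>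
      ev c z = ev (a i) (chain_boundary (Suc p) z)"
    by metis
  have "\<forall>j. \<exists>b. j \<in> J \<longrightarrow> (\<forall>z. singular_chain (Suc p) (subtopology X (V j)) z \<longrightarrow>
      ev c z = ev b (chain_boundary (Suc p) z))"
    using vanV cS unfolding cohomology_vanishes_def exact_cochain_def by blast
  then obtain b where b: "\<And>j z. j \<in> J \<Longrightarrow> singular_chain (Suc p) (subtopology X (V j)) z \<Longrightarrow>
      ev c z = ev (b j) (chain_boundary (Suc p) z)"
    by metis
  have w: "closed_cochain p (subtopology X (U i \<inter> V j)) (\<lambda>s. a i s - b j s)" if "i \<in> I" "j \<in> J" for i j
    unfolding closed_cochain_def ev_cochain_diff
  proof (intro allI impI)
    fix z assume "singular_chain (Suc p) (subtopology X (U i \<inter> V j)) z"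
    then have z: "singular_chain (Suc p) (subtopology X (U i)) z"
        "singular_chain (Suc p) (subtopology X (V j)) z"
      by (auto intro: singular_chain_mono)
    show "ev (a i) (chain_boundary (Suc p) z) - ev (b j) (chain_boundary (Suc p) z) = 0"
      using a[OF that(1) z(1)] b[OF that(2) z(2)] by simp
  qed
  have "\<forall>i. \<exists>a'. i \<in> I \<longrightarrow> closed_cochain p (subtopology X (U i)) a' \<and>
        (\<forall>j\<in>J. exact_cochain p (subtopology X (U i \<inter> V j)) (\<lambda>s. a i s - b j s - a' s))"
    using surj[where w = "\<lambda>j s. a i s - b j s" for i] w by blast
  then obtain a' where a': "\<And>i. i \<in> I \<Longrightarrow> closed_cochain p (subtopology X (U i)) (a' i)"
      "\<And>i j. i \<in> I \<Longrightarrow> j \<in> J \<Longrightarrow> exact_cochain p (subtopology X (U i \<inter> V j)) (\<lambda>s. a i s - b j s - a' i s)"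
    by metis
  have "\<forall>i j. \<exists>e. i \<in> I \<and> j \<in> J \<longrightarrow> (\<forall>z. singular_chain p (subtopology X (U i \<inter> V j)) z \<longrightarrow>
      ev (\<lambda>s. a i s - b j s - a' i s) z = ev e (chain_boundary p z))"
    using a'(2) unfolding exact_cochain_def by blast
  then obtain e where e: "\<And>i j z. i \<in> I \<Longrightarrow> j \<in> J \<Longrightarrow> singular_chain p (subtopology X (U i \<inter> V j)) z \<Longrightarrow>
      ev (\<lambda>s. a i s - b j s - a' i s) z = ev (e i j) (chain_boundary p z)"
    by metis
  have "\<forall>j. \<exists>E. \<forall>i s. i \<in> I \<longrightarrow> singular_simplex (p - 1) (subtopology X (U i)) s \<longrightarrow> E s = e i j s"
    by (intro allI glue_disjoint_cochains[OF U(2), where a = "\<lambda>i. e i j" for j])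
  then obtain E where E: "\<And>i j s. i \<in> I \<Longrightarrow> singular_simplex (p - 1) (subtopology X (U i)) s \<Longrightarrow>
      E j s = e i j s"
    by metis
  \<comment> \<open>Adding a coboundary keeps \<open>\<beta> j\<close> a primitive of
    \<open>c\<close> on \<open>V j\<close>, and makes it equal to the corrected
    \<open>a i - a' i\<close> on the overlaps.\<close>
  define \<beta> where "\<beta> j s = b j s + ev (E j) (chain_boundary p (frag_of s))" for j s
  have ev_\<beta>: "ev (\<beta> j) z = ev (b j) z + ev (E j) (chain_boundary p z)" for j z
    by (rule ev_unique[of z UNIV]) (auto simp: \<beta>_def ev_diff chain_boundary_diff)
  have agree: "a i s - a' i s = \<beta> j s"
    if "i \<in> I" "j \<in> J" "singular_simplex p (subtopology X (U i \<inter> V j)) s" for i j s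
  proof -
    have "singular_chain p (subtopology X (U i)) (frag_of s)"
      using that(3) by (auto simp: singular_chain_of singular_simplex_subtopology)
    then have "singular_chain (p - 1) (subtopology X (U i)) (chain_boundary p (frag_of s))"
      using singular_chain_boundary by simp
    then have "ev (E j) (chain_boundary p (frag_of s)) = ev (e i j) (chain_boundary p (frag_of s))"
      using E[OF that(1)] by (rule ev_eq_on_chain)
    then show ?thesis
      using e[OF that(1,2), of "frag_of s"] that(3) by (simp add: \<beta>_def singular_chain_of)
  qed
  obtain g where g: "\<And>i s. i \<in> I \<Longrightarrow> singular_simplex p (subtopology X (U i)) s \<Longrightarrow> g s = a i s - a' i s"
    "\<And>j s. j \<in> J \<Longrightarrow> singular_simplex p (subtopology X (V j)) s \<Longrightarrow> g s = \<beta> j s"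
    by (rule glue_cochains[OF U(2) V(2), of p X "\<lambda>i s. a i s - a' i s" \<beta>]) (use agree in auto)
  have small: "ev c z = ev g (chain_boundary (Suc p) z)"
    if "small_chain (U ` I \<union> V ` J) (Suc p) X z" for z
    using that
  proof (rule ev_small_chain_eqI)
    fix i and z :: "'b chain"
    assume i: "i \<in> I" and z: "singular_chain (Suc p) (subtopology X (U i)) z"
    have "ev g (chain_boundary (Suc p) z) = ev (\<lambda>s. a i s - a' i s) (chain_boundary (Suc p) z)"
      using singular_chain_boundary_alt[OF z] g(1)[OF i] by (rule ev_eq_on_chain)
    then show "ev c z = ev g (chain_boundary (Suc p) z)"
      using a'(1)[OF i] a[OF i z] z by (simp add: closed_cochain_def ev_cochain_diff)
  next
    fix j and z :: "'b chain"
    assume j: "j \<in> J" and z: "singular_chain (Suc p) (subtopology X (V j)) z"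
    have "ev g (chain_boundary (Suc p) z) = ev (\<beta> j) (chain_boundary (Suc p) z)"
      using singular_chain_boundary_alt[OF z] g(2)[OF j] by (rule ev_eq_on_chain)
    then show "ev c z = ev g (chain_boundary (Suc p) z)"
      by (simp add: ev_\<beta> chain_boundary_boundary_alt[OF z] b[OF j z])
  qed (auto simp: ev_diff chain_boundary_diff)
  show "exact_cochain (Suc p) X c"
    by (rule exact_cochain_if_small_exact[where \<C> = "U ` I \<union> V ` J", OF _ _ c small])
       (use U(1) V(1) cover in auto)
qed

section \<open>Points on the line without triple collisions\<close>

text \<open>Configurations are functions on the whole index type, with coordinates outside
  \<open>S\<close> unrestricted. These form a contractible factor, and forgetting points becomes an
  inclusion of sets such as \<open>no_triple S \<subseteq> no_triple T\<close>.\<close>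

definition no_triple :: "'i set \<Rightarrow> ('i \<Rightarrow> real) set"
  where "no_triple S = {x. \<forall>i\<in>S. \<forall>j\<in>S. \<forall>k\<in>S. i \<noteq> j \<and> j \<noteq> k \<and> i \<noteq> k \<longrightarrow> \<not> (x i = x j \<and> x j = x k)}"

text \<open>For a singleton \<open>e\<close> this is the stratum with a given leftmost point. For a
  pair it is an open thickening of the stratum where the two share the leftmost position: their
  mutual order is left open.\<close>

definition bottom_block :: "'i set \<Rightarrow> 'i set \<Rightarrow> ('i \<Rightarrow> real) set"
  where "bottom_block S e = {x \<in> no_triple S. \<forall>i\<in>e. \<forall>k\<in>S - e. x i < x k}"

lemma no_triple_mono: "T \<subseteq> S \<Longrightarrow> no_triple S \<subseteq> no_triple T"
  unfolding no_triple_def by blast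

lemma not_all_distinct_if_card_le_2:
  assumes "finite e" "card e \<le> 2" "i \<in> e" "j \<in> e" "k \<in> e"
  shows "i = j \<or> j = k \<or> i = k"
proof (rule ccontr)
  assume "\<not> ?thesis"
  then have "card {i, j, k} = 3"
    by auto
  moreover have "card {i, j, k} \<le> card e"
    using assms by (intro card_mono) auto
  ultimately show False
    using assms(2) by simp
qed

text \<open>A coincidence cannot mix \<open>e\<close> with its complement, because of the strict
  inequalities, and \<open>e\<close> is too small to contain three distinct indices.\<close>

lemma bottom_block_eq:
  assumes "finite S" "e \<subseteq> S" "card e \<le> 2"
  shows "bottom_block S e = {x \<in> no_triple (S - e). \<forall>i\<in>e. \<forall>k\<in>S - e. x i < x k}"
proof
  show "bottom_block S e \<subseteq> {x \<in> no_triple (S - e). \<forall>i\<in>e. \<forall>k\<in>S - e. x i < x k}"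
    unfolding bottom_block_def using no_triple_mono[of "S - e" S] by blast
  show "{x \<in> no_triple (S - e). \<forall>i\<in>e. \<forall>k\<in>S - e. x i < x k} \<subseteq> bottom_block S e"
  proof clarify
    fix x assume x: "x \<in> no_triple (S - e)" and less: "\<forall>i\<in>e. \<forall>k\<in>S - e. x i < x k"
    have "\<not> (x i = x j \<and> x j = x k)"
      if "i \<in> S" "j \<in> S" "k \<in> S" "i \<noteq> j" "j \<noteq> k" "i \<noteq> k" for i j k
    proof
      assume eq: "x i = x j \<and> x j = x k"
      have same: "l \<in> e \<longleftrightarrow> l' \<in> e" if "l \<in> S" "l' \<in> S" "x l = x l'" for l l'
        using less that by (metis DiffI less_irrefl)
      show False
      proof (cases "i \<in> e")
        case True
        then have "j \<in> e" "k \<in> e"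
          using same[of i j] same[of i k] that eq by auto
        then show False
          using not_all_distinct_if_card_le_2[OF _ assms(3) True] that assms finite_subset by blast
      next
        case False
        then have "i \<in> S - e" "j \<in> S - e" "k \<in> S - e"
          using same[of i j] same[of i k] that eq by auto
        then show False
          using x eq that unfolding no_triple_def by blast
      qed
    qed
    then show "x \<in> bottom_block S e"
      using less unfolding bottom_block_def no_triple_def by blast
  qed
qed

lemma openin_bottom_block:
  assumes "finite S" "e \<subseteq> S"
  shows "openin (top_of_set (no_triple S)) (bottom_block S e)"
proof -
  have "open (\<Inter>i\<in>e. \<Inter>k\<in>S - e. {x :: _ \<Rightarrow> real. x i < x k})"
    using assms by (intro open_INT ballI open_Collect_less) (auto intro: finite_subset)
  moreover have "bottom_block S e = no_triple S \<inter> (\<Inter>i\<in>e. \<Inter>k\<in>S - e. {x. x i < x k})"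
    by (auto simp: bottom_block_def)
  ultimately show ?thesis
    by (simp add: openin_open_Int)
qed

text \<open>Two distinct sets of equal size each contain an index missing from the other, and each
  of these two points would have to lie below the other one.\<close>

lemma bottom_block_disjoint:
  assumes "finite S" "e \<subseteq> S" "e' \<subseteq> S" "card e = card e'" "e \<noteq> e'"
  shows "bottom_block S e \<inter> bottom_block S e' = {}"
proof -
  have fin: "finite e" "finite e'"
    using assms finite_subset by auto
  have "\<not> e \<subseteq> e'" "\<not> e' \<subseteq> e"
    using card_subset_eq[OF fin(2)] card_subset_eq[OF fin(1)] assms by metis+
  then obtain i k where ik: "i \<in> e" "i \<notin> e'" "k \<in> e'" "k \<notin> e"
    by blast
  have "x i < x k \<and> x k < x i" if "x \<in> bottom_block S e \<inter> bottom_block S e'" for x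
    using that ik assms(2,3) unfolding bottom_block_def by blast
  then show ?thesis
    by (meson all_not_in_conv less_asym)
qed

text \<open>The indices attaining the minimum form a nonempty set of at most two elements, and this
  set is a suitable \<open>e\<close>.\<close>

lemma no_triple_cover:
  assumes "finite S" "S \<noteq> {}" "x \<in> no_triple S"
  shows "(\<exists>i\<in>S. x \<in> bottom_block S {i}) \<or> (\<exists>e. e \<subseteq> S \<and> card e = 2 \<and> x \<in> bottom_block S e)"
proof -
  define m where "m = Min (x ` S)"
  define e where "e = {i \<in> S. x i = m}"
  have m: "m \<in> x ` S" "\<And>k. k \<in> S \<Longrightarrow> m \<le> x k"
    using assms by (auto simp: m_def)
  have fin: "finite e" "e \<subseteq> S"
    using assms by (auto simp: e_def)
  have "x i < x k" if "i \<in> e" "k \<in> S - e" for i k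
  proof -
    have "x i = m" "x k \<noteq> m" "m \<le> x k"
      using that m(2) by (auto simp: e_def)
    then show ?thesis
      by simp
  qed
  then have x: "x \<in> bottom_block S e"
    using assms(3) by (auto simp: bottom_block_def)
  have "card e \<noteq> 0"
    using m(1) fin by (auto simp: e_def)
  moreover have "card e < 3"
  proof (rule ccontr)
    assume "\<not> card e < 3"
    then obtain T where "T \<subseteq> e" "card T = 3"
      by (metis not_less obtain_subset_with_card_n)
    then obtain i j k where ijk: "{i, j, k} \<subseteq> e" "i \<noteq> j" "j \<noteq> k" "i \<noteq> k"
      by (auto simp: card_3_iff)
    then have "i \<in> S" "j \<in> S" "k \<in> S" "x i = x j" "x j = x k"
      by (auto simp: e_def)
    then show False
      using assms(3) ijk unfolding no_triple_def by blast
  qed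
  ultimately consider "card e = 1" | "card e = 2"
    by linarith
  then show ?thesis
    using x fin by cases (auto simp: card_1_singleton_iff)
qed

section \<open>Straight-line retractions\<close>

lemma homotopic_with_line:
  fixes f :: "('i \<Rightarrow> real) \<Rightarrow> 'i \<Rightarrow> real"
  assumes f: "continuous_on A f"
    and line: "\<And>x u. x \<in> A \<Longrightarrow> 0 \<le> u \<Longrightarrow> u \<le> 1 \<Longrightarrow> (\<lambda>i. (1 - u) * f x i + u * x i) \<in> A"
  shows "homotopic_with (\<lambda>_. True) (top_of_set A) (top_of_set A) f id"
  unfolding homotopic_with_def
proof (intro exI[of _ "\<lambda>(u, x) i. (1 - u) * f x i + u * x i"] conjI)
  have "continuous_on ({0..1} \<times> A) (\<lambda>p i. (1 - fst p) * f (snd p) i + fst p * snd p i)"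
  proof (rule continuous_on_coordinatewise_then_product)
    fix i
    have 1: "continuous_on ({0..1} \<times> A) (\<lambda>p :: real \<times> ('i \<Rightarrow> real). f (snd p) i)"
      by (rule continuous_on_compose2[OF continuous_on_product_then_coordinatewise[OF f, of i]
            continuous_on_snd[OF continuous_on_id]]) auto
    have 2: "continuous_on ({0..1} \<times> A) (\<lambda>p :: real \<times> ('i \<Rightarrow> real). snd p i)"
      by (rule continuous_on_compose2[OF continuous_on_product_coordinates[of i]
            continuous_on_snd[OF continuous_on_id]]) auto
    have 3: "continuous_on ({0..1} \<times> A) (\<lambda>p :: real \<times> ('i \<Rightarrow> real). fst p)"
      by (rule continuous_on_fst[OF continuous_on_id])
    show "continuous_on ({0..1} \<times> A) (\<lambda>p. (1 - fst p) * f (snd p) i + fst p * snd p i)"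
      by (rule continuous_on_add[OF continuous_on_mult[OF continuous_on_diff[OF continuous_on_const 3] 1]
            continuous_on_mult[OF 3 2]])
  qed
  then show "continuous_map (prod_topology (top_of_set {0..1}) (top_of_set A)) (top_of_set A)
      (\<lambda>(u, x) i. (1 - u) * f x i + u * x i)"
    using line by (auto simp: prod_topology_subtopology_eu case_prod_unfold)
qed auto

text \<open>The restriction of \<open>f\<close> to \<open>A\<close> is joined to the identity inside
  \<open>A\<close>, so every class on \<open>A\<close> is the restriction of a class on the larger
  set \<open>A'\<close>.\<close>

lemma exact_cochain_line_retract:
  fixes f :: "('i \<Rightarrow> real) \<Rightarrow> 'i \<Rightarrow> real"
  assumes "A \<subseteq> A'" and f: "continuous_on A' f" "\<And>x. x \<in> A' \<Longrightarrow> f x \<in> A"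
    and line: "\<And>x u. x \<in> A \<Longrightarrow> 0 \<le> u \<Longrightarrow> u \<le> 1 \<Longrightarrow> (\<lambda>i. (1 - u) * f x i + u * x i) \<in> A"
    and c: "closed_cochain p (top_of_set A) c"
  shows "closed_cochain p (top_of_set A') (pullback p f c)"
    and "exact_cochain p (top_of_set A) (\<lambda>s. c s - pullback p f c s)"
proof -
  have cont: "continuous_map (top_of_set A') (top_of_set A) f"
    using f by auto
  have incl: "continuous_map (top_of_set A) (top_of_set A') id"
    using assms(1) by auto
  have "homotopic_with (\<lambda>_. True) (top_of_set A) (top_of_set A) (f \<circ> id) id"
    using homotopic_with_line[of A f] line continuous_on_subset[OF f(1) assms(1)] by simp
  note ex = exact_cochain_pullback_homotopic_id[OF incl cont this c]
  show "closed_cochain p (top_of_set A') (pullback p f c)"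
    by (rule closed_cochain_pullback[OF c cont])
  show "exact_cochain p (top_of_set A) (\<lambda>s. c s - pullback p f c s)"
  proof (rule exact_cochain_cong[OF ex])
    fix s assume "singular_simplex p (top_of_set A) s"
    then have "simplex_map p id s = s"
      by (intro simplex_map_id_gen) auto
    then show "c s - pullback p id (pullback p f c) s = c s - pullback p f c s"
      by (simp add: pullback_def del: simplex_map_id)
  qed
qed

lemma cohomology_vanishes_line_retract:
  fixes f :: "('i \<Rightarrow> real) \<Rightarrow> 'i \<Rightarrow> real"
  assumes "A \<subseteq> A'" "continuous_on A' f" "\<And>x. x \<in> A' \<Longrightarrow> f x \<in> A"
    and "\<And>x u. x \<in> A \<Longrightarrow> 0 \<le> u \<Longrightarrow> u \<le> 1 \<Longrightarrow> (\<lambda>i. (1 - u) * f x i + u * x i) \<in> A"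
    and van: "cohomology_vanishes p (top_of_set A')"
  shows "cohomology_vanishes p (top_of_set A)"
  unfolding cohomology_vanishes_def
proof (intro allI impI)
  fix c assume "closed_cochain p (top_of_set A) c"
  note c = exact_cochain_line_retract[OF assms(1-4) this]
  have "exact_cochain p (top_of_set A) (pullback p f c)"
    using van c(1) exact_cochain_subtopology[OF _ assms(1)] by (auto simp: cohomology_vanishes_def)
  from exact_cochain_add[OF c(2) this] show "exact_cochain p (top_of_set A) c"
    by simp
qed

lemma convex_combination_less:
  fixes a b c u :: real
  assumes "a < c" "b < c" "0 \<le> u" "u \<le> 1"
  shows "(1 - u) * a + u * b < c"
  using convex_bound_lt[of a c b "1 - u" u] assms by simp

lemma cohomology_vanishes_bottom_block:
  assumes "finite S" "e \<subseteq> S" "card e \<le> 2" and van: "cohomology_vanishes p (top_of_set (no_triple (S - e)))"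
  shows "cohomology_vanishes p (top_of_set (bottom_block S e))"
proof (rule cohomology_vanishes_line_retract[OF _ _ _ _ van])
  note eq = bottom_block_eq[OF assms(1-3)]
  \<comment> \<open>A continuous choice of a position below all points indexed by
    \<open>S - e\<close>; the points of \<open>e\<close>, free in \<open>no_triple (S - e)\<close>,
    are moved there together.\<close>
  define f where "f x i = (if i \<in> e then - 1 - (\<Sum>k\<in>S - e. \<bar>x k\<bar>) else x i)" for x :: "'a \<Rightarrow> real" and i
  have f_less: "f x i < x k" if "i \<in> e" "k \<in> S - e" for x i k
  proof -
    have "\<bar>x k\<bar> \<le> (\<Sum>k\<in>S - e. \<bar>x k\<bar>)"
      using that assms(1) by (intro member_le_sum) auto
    then show ?thesis
      using that by (simp add: f_def)
  qed
  show "bottom_block S e \<subseteq> no_triple (S - e)"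
    using eq by auto
  show "continuous_on (no_triple (S - e)) f"
  proof (rule continuous_on_coordinatewise_then_product)
    fix i
    show "continuous_on (no_triple (S - e)) (\<lambda>x. f x i)"
      unfolding f_def
      by (cases "i \<in> e")
         (auto intro!: continuous_intros continuous_on_subset[OF continuous_on_product_coordinates])
  qed
  show "f x \<in> bottom_block S e" if "x \<in> no_triple (S - e)" for x
  proof -
    have "f x \<in> no_triple (S - e)"
      using that by (simp add: no_triple_def f_def)
    then show ?thesis
      using f_less by (auto simp: eq f_def)
  qed
  show "(\<lambda>i. (1 - u) * f x i + u * x i) \<in> bottom_block S e"
    if x: "x \<in> bottom_block S e" and u: "0 \<le> u" "u \<le> 1" for x u
  proof -
    let ?y = "\<lambda>i. (1 - u) * f x i + u * x i"
    have y: "?y k = x k" if "k \<in> S - e" for k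
      using that by (simp add: f_def algebra_simps)
    have "?y i < ?y k" if "i \<in> e" "k \<in> S - e" for i k
      unfolding y[OF that(2)] using x that u f_less[OF that]
      by (intro convex_combination_less) (auto simp: eq)
    moreover have "?y \<in> no_triple (S - e)"
      using x y by (auto simp: eq no_triple_def)
    ultimately show ?thesis
      by (auto simp: eq)
  qed
qed

text \<open>On the overlap \<open>i\<close> is leftmost and \<open>j\<close> comes next. Forgetting
  \<open>i\<close> leaves a configuration with leftmost point \<open>j\<close>; this links the
  overlaps for \<open>S\<close> with the strata for \<open>S - {i}\<close>.\<close>

lemma bottom_block_pair_eq:
  assumes "finite S" "i \<in> S" "j \<in> S" "i \<noteq> j"
  shows "bottom_block S {i} \<inter> bottom_block S {i, j} = {x \<in> bottom_block (S - {i}) {j}. x i < x j}"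
proof -
  have "card {i, j} = 2"
    using assms by simp
  moreover have "S - {i} - {j} = S - {i, j}"
    by auto
  ultimately have "bottom_block S {i, j} = {x \<in> no_triple (S - {i, j}). \<forall>l\<in>{i, j}. \<forall>k\<in>S - {i, j}. x l < x k}"
    "bottom_block (S - {i}) {j} = {x \<in> no_triple (S - {i, j}). \<forall>k\<in>S - {i, j}. x j < x k}"
    using bottom_block_eq[of S "{i, j}"] bottom_block_eq[of "S - {i}" "{j}"] assms by auto
  moreover have "bottom_block S {i} \<inter> bottom_block S {i, j} = {x \<in> bottom_block S {i, j}. \<forall>k\<in>S - {i}. x i < x k}"
    by (auto simp: bottom_block_def)
  ultimately show ?thesis
    using assms by (auto intro: less_trans)
qed

text \<open>Coordinate \<open>i\<close> is free in \<open>bottom_block (S - {i}) {j}\<close>;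
  putting it at \<open>x j - 1\<close> is the simplest continuous way to make it smaller than
  \<open>x j\<close>.\<close>

lemma pair_block_line_retract:
  assumes "finite S" "i \<in> S" "j \<in> S" "i \<noteq> j"
  defines "f \<equiv> \<lambda>x. x(i := x j - 1)" and "W \<equiv> bottom_block S {i} \<inter> bottom_block S {i, j}"
  shows "W \<subseteq> bottom_block (S - {i}) {j}"
    and "continuous_on (bottom_block (S - {i}) {j}) f"
    and "x \<in> bottom_block (S - {i}) {j} \<Longrightarrow> f x \<in> W"
    and "x \<in> W \<Longrightarrow> 0 \<le> u \<Longrightarrow> u \<le> 1 \<Longrightarrow> (\<lambda>k. (1 - u) * f x k + u * x k) \<in> W"
proof -
  have W: "W = {x \<in> bottom_block (S - {i}) {j}. x i < x j}"
    unfolding W_def by (rule bottom_block_pair_eq[OF assms(1-4)])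
  have local: "y \<in> bottom_block (S - {i}) {j}"
    if "x \<in> bottom_block (S - {i}) {j}" "\<And>k. k \<noteq> i \<Longrightarrow> y k = x k" for x y
    using that assms(3,4) by (simp add: bottom_block_def no_triple_def)
  show "W \<subseteq> bottom_block (S - {i}) {j}"
    by (auto simp: W)
  show "continuous_on (bottom_block (S - {i}) {j}) f"
  proof (rule continuous_on_coordinatewise_then_product)
    fix k
    show "continuous_on (bottom_block (S - {i}) {j}) (\<lambda>x. f x k)"
      unfolding f_def
      by (cases "k = i")
         (auto intro!: continuous_intros continuous_on_subset[OF continuous_on_product_coordinates])
  qed
  show "f x \<in> W" if "x \<in> bottom_block (S - {i}) {j}"
    using local[OF that, of "f x"] assms(4) by (auto simp: W f_def)
  show "(\<lambda>k. (1 - u) * f x k + u * x k) \<in> W" if x: "x \<in> W" and u: "0 \<le> u" "u \<le> 1"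
  proof -
    let ?y = "\<lambda>k. (1 - u) * f x k + u * x k"
    have y: "?y k = x k" if "k \<noteq> i" for k
      using that by (simp add: f_def algebra_simps)
    have "?y i < x j"
      using x u by (intro convex_combination_less) (auto simp: W f_def)
    then show ?thesis
      using local[of x ?y] x y y[of j] assms(4) by (auto simp: W)
  qed
qed

text \<open>For \<open>i \<in> e\<close> two retractions in succession forget first \<open>i\<close>
  and then the other element of \<open>e\<close>. For \<open>i \<notin> e\<close> a point of
  \<open>e\<close> would lie both above and below \<open>i\<close>, so the overlap is empty.\<close>

lemma cohomology_vanishes_pair_block:
  assumes "finite S" "i \<in> S" "e \<subseteq> S" "card e = 2"
    and van: "cohomology_vanishes p (top_of_set (no_triple (S - e)))"
  shows "cohomology_vanishes p (top_of_set (bottom_block S {i} \<inter> bottom_block S e))"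
proof (cases "i \<in> e")
  case True
  then obtain j where j: "e = {i, j}" "i \<noteq> j"
    using assms(4) by (metis card_2_iff doubleton_eq_iff insert_iff singletonD)
  then have "j \<in> S"
    using assms(3) by auto
  have "S - {i} - {j} = S - e"
    using j by auto
  then have "cohomology_vanishes p (top_of_set (bottom_block (S - {i}) {j}))"
    using assms(1) \<open>j \<in> S\<close> j van by (intro cohomology_vanishes_bottom_block) auto
  then show ?thesis
    unfolding j(1)
    by (rule cohomology_vanishes_line_retract[rotated 4])
       (use pair_block_line_retract[OF assms(1,2) \<open>j \<in> S\<close> j(2)] in blast)+
next
  case False
  obtain k where k: "k \<in> e"
    using assms(4) by fastforce
  have "bottom_block S {i} \<inter> bottom_block S e = {}"
  proof -
    have "x i < x k \<and> x k < x i" if "x \<in> bottom_block S {i} \<inter> bottom_block S e" for x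
      using that False k assms(2,3) unfolding bottom_block_def by blast
    then show ?thesis
      by (meson all_not_in_conv less_asym)
  qed
  then show ?thesis
    by (simp add: cohomology_vanishes_def exact_cochain_empty)
qed

lemma subtopology_bottom_block [simp]:
  "subtopology (top_of_set (no_triple S)) (bottom_block S e) = top_of_set (bottom_block S e)"
  "subtopology (top_of_set (no_triple S)) (bottom_block S e \<inter> A) = top_of_set (bottom_block S e \<inter> A)"
  by (simp_all add: subtopology_subtopology bottom_block_def Int_absorb1 subset_eq Collect_conj_eq)

lemma bottom_block_families:
  assumes "finite S"
  shows "disjoint_family_on (\<lambda>i. bottom_block S {i}) S"
    and "disjoint_family_on (bottom_block S) {e. e \<subseteq> S \<and> card e = 2}"
  using bottom_block_disjoint[OF assms] by (auto simp: disjoint_family_on_def)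

text \<open>In the dimension where the induction on the number of points has no room to spare,
  this extension property replaces the missing vanishing.\<close>

lemma closed_cochain_extend_bottom:
  fixes S :: "'i set"
  assumes "finite S" "card S mod 3 = 1"
    and van: "\<And>(T :: 'i set) p. T \<subset> S \<Longrightarrow> card T div 3 < p \<Longrightarrow> cohomology_vanishes p (top_of_set (no_triple T))"
    and u: "\<And>i. i \<in> S \<Longrightarrow> closed_cochain (card S div 3) (top_of_set (bottom_block S {i})) (u i)"
  obtains c where "closed_cochain (card S div 3) (top_of_set (no_triple S)) c"
    "\<And>i s. i \<in> S \<Longrightarrow> singular_simplex (card S div 3) (top_of_set (bottom_block S {i})) s \<Longrightarrow> c s = u i s"
proof -
  let ?p = "card S div 3" and ?X = "top_of_set (no_triple S)"
  have ex: "exact_cochain ?p (subtopology ?X (bottom_block S {i} \<inter> bottom_block S e)) (u i)"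
    if "i \<in> S" "e \<subseteq> S" "card e = 2" for i e
  proof -
    have "card (S - e) = card S - 2"
      using that assms(1) by (simp add: card_Diff_subset finite_subset)
    \<comment> \<open>This guards the truncated subtraction: for \<open>card S = 1\<close> the
      strict inequality below would be false. With \<open>card S = 3 * q + 1\<close> the overlaps
      involve \<open>3 * q - 1\<close> points, so the quotient drops below \<open>q\<close>.\<close>
    moreover have "card S \<ge> 2"
      using that assms(1) card_mono by metis
    ultimately have "card (S - e) div 3 < ?p"
      using assms(2) by presburger
    then have "cohomology_vanishes ?p (top_of_set (no_triple (S - e)))"
      using that by (intro van) auto
    then have "cohomology_vanishes ?p (top_of_set (bottom_block S {i} \<inter> bottom_block S e))"
      using that assms(1) by (intro cohomology_vanishes_pair_block) auto
    moreover have "closed_cochain ?p (top_of_set (bottom_block S {i} \<inter> bottom_block S e)) (u i)"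
      using closed_cochain_subtopology[OF u[OF that(1)]] by blast
    ultimately show ?thesis
      by (simp add: cohomology_vanishes_def)
  qed
  have "S \<noteq> {}"
    using assms(2) by auto
  then have cover: "topspace ?X \<subseteq> \<Union>((\<lambda>i. bottom_block S {i}) ` S) \<union> \<Union>(bottom_block S ` {e. e \<subseteq> S \<and> card e = 2})"
    using no_triple_cover[OF assms(1)] by auto
  obtain c where "closed_cochain ?p ?X c"
    "\<And>i s. i \<in> S \<Longrightarrow> singular_simplex ?p (subtopology ?X (bottom_block S {i})) s \<Longrightarrow> c s = u i s"
    by (rule closed_cochain_glue[where p = ?p, OF _ bottom_block_families(1)[OF assms(1)] _
          bottom_block_families(2)[OF assms(1)] cover, of u])
       (use u ex openin_bottom_block[OF assms(1)] in auto)
  then show ?thesis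
    using that by simp
qed

text \<open>Removing two points lowers the quotient by three unless the remainder is 2; this
  isolates the single critical case of the induction.\<close>

lemma minus_2_div_3_less:
  fixes n q :: nat
  assumes "n div 3 \<le> q" "\<not> (n mod 3 = 2 \<and> q = n div 3)" "2 \<le> n"
  shows "(n - 2) div 3 < q"
  using assms by presburger

text \<open>The members of the cover have fewer effective points, so they are covered by induction
  in the same degree. The work lies in \<open>surj\<close>, one degree lower: the overlaps vanish
  there except in the critical case \<open>card S = 3 * q + 2\<close>.\<close>

theorem cohomology_vanishes_no_triple:
  fixes S :: "'i set"
  assumes "finite S" "card S div 3 < p"
  shows "cohomology_vanishes p (top_of_set (no_triple S))"
  using assms
proof (induction S arbitrary: p rule: finite_psubset_induct)
  case (psubset S)
  have van: "cohomology_vanishes p (top_of_set (no_triple T))" if "T \<subset> S" "card T div 3 < p" for T p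
    using psubset.IH[OF that] .
  obtain q where q: "p = Suc q"
    using psubset.prems by (cases p) auto
  show ?case
  proof (cases "S = {}")
    case True
    \<comment> \<open>With no points there is no condition: \<open>no_triple {}\<close> is the full
      function space, contracted linearly to the zero function.\<close>
    have "homotopic_with (\<lambda>_. True) (top_of_set UNIV) (top_of_set UNIV) ((\<lambda>x. x) \<circ> (\<lambda>x :: 'i \<Rightarrow> real. \<lambda>i. 0)) id"
      using homotopic_with_line[of UNIV "\<lambda>x :: 'i \<Rightarrow> real. \<lambda>i. 0"] by (simp add: o_def)
    moreover have "cohomology_vanishes p (top_of_set {\<lambda>i :: 'i. 0 :: real})"
      using psubset.prems by (intro cohomology_vanishes_singleton) auto
    ultimately have "cohomology_vanishes p (top_of_set (UNIV :: ('i \<Rightarrow> real) set))"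
      using cohomology_vanishes_dominated[of "top_of_set UNIV" "top_of_set {\<lambda>i. 0}" "\<lambda>x i. 0" "\<lambda>x. x" p]
      by auto
    then show ?thesis
      using True by (simp add: no_triple_def)
  next
    case False
    let ?X = "top_of_set (no_triple S)" and ?J = "{e. e \<subseteq> S \<and> card e = 2}"
    have cover: "topspace ?X \<subseteq> \<Union>((\<lambda>i. bottom_block S {i}) ` S) \<union> \<Union>(bottom_block S ` ?J)"
      using no_triple_cover[OF psubset.hyps False] by auto
    have pos: "card S > 0"
      using False psubset.hyps by auto
    have card1: "card (S - {i}) = card S - 1" if "i \<in> S" for i
      using that by simp
    have card2: "card (S - e) = card S - 2" "card S \<ge> 2" if "e \<in> ?J" for e
      using that psubset.hyps card_mono[of S e] by (auto simp: card_Diff_subset finite_subset)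
    have smaller: "S - e \<subset> S" if "e \<in> ?J" for e
    proof -
      have "e \<noteq> {}" "e \<subseteq> S"
        using that by auto
      then show ?thesis
        by blast
    qed
    have vanU: "cohomology_vanishes (Suc q) (subtopology ?X (bottom_block S {i}))" if "i \<in> S" for i
    proof -
      have "card (S - {i}) div 3 < p"
        using psubset.prems card1[OF that] div_le_mono[of "card S - 1" "card S" 3] by simp
      then have "cohomology_vanishes p (top_of_set (no_triple (S - {i})))"
        using that by (intro van) auto
      then show ?thesis
        using that psubset.hyps cohomology_vanishes_bottom_block[of S "{i}" p] by (simp add: q)
    qed
    have vanV: "cohomology_vanishes (Suc q) (subtopology ?X (bottom_block S e))" if "e \<in> ?J" for e
    proof -
      have "card (S - e) div 3 < p"
        using psubset.prems card2[OF that] div_le_mono[of "card S - 2" "card S" 3] by simp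
      moreover have "S - e \<subset> S"
        by (rule smaller[OF that])
      ultimately have "cohomology_vanishes p (top_of_set (no_triple (S - e)))"
        by (intro van)
      then show ?thesis
        using that psubset.hyps cohomology_vanishes_bottom_block[of S e p] by (simp add: q)
    qed
    have surj: "\<exists>a. closed_cochain q (subtopology ?X (bottom_block S {i})) a \<and>
        (\<forall>e\<in>?J. exact_cochain q (subtopology ?X (bottom_block S {i} \<inter> bottom_block S e)) (\<lambda>s. w e s - a s))"
      if i: "i \<in> S" and w: "\<And>e. e \<in> ?J \<Longrightarrow>
        closed_cochain q (subtopology ?X (bottom_block S {i} \<inter> bottom_block S e)) (w e)" for w i
    proof (cases "card S mod 3 = 2 \<and> q = card S div 3")
      case True
      \<comment> \<open>The critical case: the overlaps inside the stratum of \<open>i\<close>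
        involve \<open>3 * q\<close> points, and the classes \<open>w\<close> are instead realised
        on \<open>no_triple ?T\<close>, where \<open>?T\<close> has \<open>3 * q + 1\<close>
        points.\<close>
      let ?T = "S - {i}"
      have "card S = 3 * q + 2"
        using True div_mult_mod_eq[of "card S" 3] by simp
      then have T: "finite ?T" "card ?T mod 3 = 1" "card ?T div 3 = q"
        using psubset.hyps card1[OF i] by auto
      \<comment> \<open>\<open>f j\<close> reinserts the point \<open>i\<close> just below
        \<open>j\<close>; pulling back along it moves \<open>w {i, j}\<close> from the overlap to
        the stratum of \<open>j\<close> in \<open>?T\<close>.\<close>
      define f where "f j x = x(i := x j - 1)" for j and x :: "'i \<Rightarrow> real"
      have wj: "closed_cochain q (top_of_set (bottom_block ?T {j})) (pullback q (f j) (w {i, j}))"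
        "exact_cochain q (top_of_set (bottom_block S {i} \<inter> bottom_block S {i, j}))
           (\<lambda>s. w {i, j} s - pullback q (f j) (w {i, j}) s)" if "j \<in> ?T" for j
      proof -
        have j: "j \<in> S" "i \<noteq> j" "{i, j} \<in> ?J"
          using that i by auto
        have "closed_cochain q (top_of_set (bottom_block S {i} \<inter> bottom_block S {i, j})) (w {i, j})"
          using w[OF j(3)] by simp
        from exact_cochain_line_retract[OF pair_block_line_retract[OF psubset.hyps i j(1,2)] this]
        show "closed_cochain q (top_of_set (bottom_block ?T {j})) (pullback q (f j) (w {i, j}))"
          "exact_cochain q (top_of_set (bottom_block S {i} \<inter> bottom_block S {i, j}))
             (\<lambda>s. w {i, j} s - pullback q (f j) (w {i, j}) s)"
          unfolding f_def by blast+
      qed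
      obtain a where a: "closed_cochain q (top_of_set (no_triple ?T)) a"
        "\<And>j s. j \<in> ?T \<Longrightarrow> singular_simplex q (top_of_set (bottom_block ?T {j})) s \<Longrightarrow>
          a s = pullback q (f j) (w {i, j}) s"
      proof (rule closed_cochain_extend_bottom[OF T(1,2)])
        show "cohomology_vanishes p (top_of_set (no_triple T))" if "T \<subset> ?T" "card T div 3 < p" for T p
          using that by (intro van) auto
        show "closed_cochain (card ?T div 3) (top_of_set (bottom_block ?T {j})) (pullback q (f j) (w {i, j}))"
          if "j \<in> ?T" for j
          using wj(1)[OF that] T(3) by simp
      qed (simp add: T(3))
      \<comment> \<open>As coordinate \<open>i\<close> is unrestricted in
        \<open>no_triple ?T\<close>, the extension \<open>a\<close> restricts directly to the
        stratum of \<open>i\<close>.\<close>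
      have "bottom_block S {i} \<subseteq> no_triple ?T"
        using no_triple_mono[of ?T S] by (auto simp: bottom_block_def)
      then have "closed_cochain q (top_of_set (bottom_block S {i})) a"
        using closed_cochain_subtopology[OF a(1)] by blast
      moreover have "exact_cochain q (top_of_set (bottom_block S {i} \<inter> bottom_block S e)) (\<lambda>s. w e s - a s)"
        if e: "e \<in> ?J" for e
      proof (cases "i \<in> e")
        case True
        then obtain j where j: "e = {i, j}" "i \<noteq> j"
          using e by (metis (mono_tags, lifting) card_2_iff doubleton_eq_iff insert_iff mem_Collect_eq singletonD)
        then have "j \<in> ?T" "j \<in> S"
          using e by auto
        show ?thesis
          unfolding j(1)
        proof (rule exact_cochain_cong[OF wj(2)[OF \<open>j \<in> ?T\<close>]])
          fix s assume s: "singular_simplex q (top_of_set (bottom_block S {i} \<inter> bottom_block S {i, j})) s"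
          have "singular_simplex q (top_of_set (bottom_block ?T {j})) s"
            using s pair_block_line_retract(1)[OF psubset.hyps i \<open>j \<in> S\<close> j(2)] by (rule singular_simplex_mono)
          then show "w {i, j} s - pullback q (f j) (w {i, j}) s = w {i, j} s - a s"
            using a(2)[OF \<open>j \<in> ?T\<close>] by simp
        qed
      next
        case False
        obtain k where k: "k \<in> e"
          using e by fastforce
        have "x i < x k \<and> x k < x i" if "x \<in> bottom_block S {i} \<inter> bottom_block S e" for x
          using that False k i e unfolding bottom_block_def by blast
        then have "bottom_block S {i} \<inter> bottom_block S e = {}"
          by (meson all_not_in_conv less_asym)
        then show ?thesis
          by (simp add: exact_cochain_empty)
      qed
      ultimately show ?thesis
        by auto
    next
      case False
      \<comment> \<open>Outside the critical case every class on the overlaps is zero, so the zero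
        cochain serves as \<open>a\<close>.\<close>
      have "exact_cochain q (subtopology ?X (bottom_block S {i} \<inter> bottom_block S e)) (\<lambda>s. w e s - 0)"
        if e: "e \<in> ?J" for e
      proof -
        have "card (S - e) div 3 < q"
          using False psubset.prems card2[OF e] minus_2_div_3_less[of "card S" q] by (simp add: q)
        moreover have "S - e \<subset> S"
          by (rule smaller[OF e])
        ultimately have "cohomology_vanishes q (top_of_set (no_triple (S - e)))"
          by (intro van)
        then have "cohomology_vanishes q (top_of_set (bottom_block S {i} \<inter> bottom_block S e))"
          using e i psubset.hyps by (intro cohomology_vanishes_pair_block) auto
        then show ?thesis
          using w[OF e] by (simp add: cohomology_vanishes_def)
      qed
      then show ?thesis
        using closed_cochain_0 by blast
    qed
    show ?thesis
      unfolding q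
      by (rule cohomology_vanishes_cover[OF _ bottom_block_families(1)[OF psubset.hyps] _
            bottom_block_families(2)[OF psubset.hyps] cover])
         (use vanU vanV surj openin_bottom_block[OF psubset.hyps] in auto)
  qed
qed

section \<open>Points on the circle\<close>

lemma openin_Collect_finite_all:
  assumes "finite F" "\<And>j. j \<in> F \<Longrightarrow> openin X {x \<in> topspace X. P j x}"
  shows "openin X {x \<in> topspace X. \<forall>j\<in>F. P j x}"
  using assms
proof (induction F rule: finite_induct)
  case (insert j F)
  have "{x \<in> topspace X. \<forall>j\<in>insert j F. P j x}
      = {x \<in> topspace X. P j x} \<inter> {x \<in> topspace X. \<forall>j\<in>F. P j x}"
    by auto
  then show ?case
    using insert by (simp add: openin_Int)
qed simp

lemma openin_Collect_less:
  assumes "continuous_map X euclideanreal f" "continuous_map X euclideanreal g"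
  shows "openin X {x \<in> topspace X. f x < g x}"
proof -
  have "continuous_map X euclideanreal (\<lambda>x. g x - f x)"
    using assms by (intro continuous_intros)
  then have "openin X {x \<in> topspace X. g x - f x \<in> {0<..}}"
    by (rule openin_continuous_map_preimage) simp
  then show ?thesis
    by simp
qed

text \<open>The picture in the chart of a point \<open>i\<close> nearest to the base point: its
  coordinate is the largest in absolute value. The sign \<open>\<sigma>\<close> tells on which side
  of the base point it lies, and the threshold 1 corresponds to positive height on the
  circle.\<close>

definition peak_block :: "real \<Rightarrow> 'i set \<Rightarrow> 'i \<Rightarrow> ('i \<Rightarrow> real) set"
  where "peak_block \<sigma> S i = {t \<in> no_triple S. 1 < \<sigma> * t i \<and> (\<forall>j\<in>S - {i}. \<bar>t j\<bar> < \<sigma> * t i)}"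

text \<open>Strict dominance keeps \<open>i\<close> away from all other points, so only triples
  among the others impose a condition.\<close>

lemma peak_block_eq:
  assumes "i \<in> S" "\<bar>\<sigma>\<bar> = 1"
  shows "peak_block \<sigma> S i = {t \<in> no_triple (S - {i}). 1 < \<sigma> * t i \<and> (\<forall>j\<in>S - {i}. \<bar>t j\<bar> < \<sigma> * t i)}"
proof -
  have "t \<in> no_triple S" if t: "t \<in> no_triple (S - {i})" and peak: "\<forall>j\<in>S - {i}. \<bar>t j\<bar> < \<sigma> * t i" for t
  proof -
    have ne: "t j \<noteq> t i" if "j \<in> S - {i}" for j
    proof
      assume "t j = t i"
      then have "\<bar>t i\<bar> < \<sigma> * t i"
        using peak that by metis
      then show False
        using abs_le_D1[of "\<sigma> * t i" "\<bar>\<sigma>\<bar> * \<bar>t i\<bar>"] assms(2) by (simp add: abs_mult)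
    qed
    show ?thesis
      unfolding no_triple_def
    proof clarify
      fix j k l
      assume *: "j \<in> S" "k \<in> S" "l \<in> S" "j \<noteq> k" "k \<noteq> l" "j \<noteq> l" "t j = t k" "t k = t l"
      then have "j \<noteq> i" "k \<noteq> i" "l \<noteq> i"
        using ne by (metis DiffI singletonD)+
      then show False
        using t * unfolding no_triple_def by blast
    qed
  qed
  then show ?thesis
    using no_triple_mono[of "S - {i}" S] unfolding peak_block_def by blast
qed

lemma convex_combination_greater:
  fixes a b c u :: real
  assumes "c < a" "c < b" "0 \<le> u" "u \<le> 1"
  shows "c < (1 - u) * a + u * b"
  using convex_combination_less[of "- a" "- c" "- b" u] assms by (simp add: algebra_simps)

lemma cohomology_vanishes_peak_block:
  assumes "finite S" "i \<in> S" "\<bar>\<sigma>\<bar> = 1" and van: "cohomology_vanishes p (top_of_set (no_triple (S - {i})))"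
  shows "cohomology_vanishes p (top_of_set (peak_block \<sigma> S i))"
proof (rule cohomology_vanishes_line_retract[OF _ _ _ _ van])
  note eq = peak_block_eq[OF assms(2,3)]
  have sq: "\<sigma> * (\<sigma> * r) = r" for r
    using assms(3) abs_mult_self_eq[of \<sigma>] by (simp flip: mult.assoc)
  \<comment> \<open>The value \<open>2 + sum\<close> exceeds both the threshold 1 and every other
    absolute value; the factor \<open>\<sigma>\<close> puts it at the correct end of the
    line.\<close>
  define f where "f t = t(i := \<sigma> * (2 + (\<Sum>k\<in>S - {i}. \<bar>t k\<bar>)))" for t :: "'a \<Rightarrow> real"
  have fi: "\<sigma> * f t i = 2 + (\<Sum>k\<in>S - {i}. \<bar>t k\<bar>)" for t
    by (simp add: f_def sq)
  have f_gr: "1 < \<sigma> * f t i" "\<And>j. j \<in> S - {i} \<Longrightarrow> \<bar>t j\<bar> < \<sigma> * f t i" for t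
  proof -
    have "0 \<le> (\<Sum>k\<in>S - {i}. \<bar>t k\<bar>)"
      by (intro sum_nonneg) auto
    then show "1 < \<sigma> * f t i"
      unfolding fi by linarith
    show "\<bar>t j\<bar> < \<sigma> * f t i" if "j \<in> S - {i}" for j
    proof -
      have "\<bar>t j\<bar> \<le> (\<Sum>k\<in>S - {i}. \<bar>t k\<bar>)"
        using that assms(1) by (intro member_le_sum) auto
      then show ?thesis
        by (simp add: fi)
    qed
  qed
  have same: "y \<in> no_triple (S - {i})" if "t \<in> no_triple (S - {i})" "\<And>k. k \<noteq> i \<Longrightarrow> y k = t k" for t y
    using that by (simp add: no_triple_def)
  show "peak_block \<sigma> S i \<subseteq> no_triple (S - {i})"
    using eq by auto
  show "continuous_on (no_triple (S - {i})) f"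
  proof (rule continuous_on_coordinatewise_then_product)
    fix k
    show "continuous_on (no_triple (S - {i})) (\<lambda>t. f t k)"
      unfolding f_def
      by (cases "k = i")
         (auto intro!: continuous_intros continuous_on_subset[OF continuous_on_product_coordinates])
  qed
  show "f t \<in> peak_block \<sigma> S i" if "t \<in> no_triple (S - {i})" for t
  proof -
    have fk: "f t k = t k" if "k \<noteq> i" for k
      using that by (simp add: f_def)
    show ?thesis
      unfolding eq using same[OF that fk] f_gr fk by auto
  qed
  show "(\<lambda>k. (1 - u) * f t k + u * t k) \<in> peak_block \<sigma> S i"
    if t: "t \<in> peak_block \<sigma> S i" and u: "0 \<le> u" "u \<le> 1" for t u
  proof -
    let ?y = "\<lambda>k. (1 - u) * f t k + u * t k"
    have y: "?y k = t k" if "k \<noteq> i" for k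
      using that by (simp add: f_def algebra_simps)
    have yi: "\<sigma> * ?y i = (1 - u) * (\<sigma> * f t i) + u * (\<sigma> * t i)"
      by (simp add: algebra_simps)
    have "1 < \<sigma> * ?y i"
      unfolding yi using t u f_gr(1) by (intro convex_combination_greater) (auto simp: eq)
    moreover have "\<bar>?y j\<bar> < \<sigma> * ?y i" if j: "j \<in> S - {i}" for j
    proof -
      have "\<bar>t j\<bar> < (1 - u) * (\<sigma> * f t i) + u * (\<sigma> * t i)"
        using t u f_gr(2)[OF j] j by (intro convex_combination_greater) (auto simp: eq)
      then show ?thesis
        using y[of j] j yi by simp
    qed
    moreover have "?y \<in> no_triple (S - {i})"
      by (rule same[of t]) (use t y in \<open>auto simp: eq\<close>)
    ultimately show ?thesis
      by (simp add: eq)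
  qed
qed

text \<open>The two signs give disjoint open pieces; the cover theorem with an empty second family
  is then additivity of cohomology.\<close>

lemma cohomology_vanishes_peak_blocks:
  assumes "finite S" "i \<in> S" "p > 0" and van: "cohomology_vanishes p (top_of_set (no_triple (S - {i})))"
  shows "cohomology_vanishes p (top_of_set (peak_block 1 S i \<union> peak_block (- 1) S i))"
proof -
  obtain q where q: "p = Suc q"
    using \<open>p > 0\<close> gr0_implies_Suc by blast
  let ?B = "peak_block 1 S i \<union> peak_block (- 1) S i"
  have sub: "subtopology (top_of_set ?B) (peak_block \<sigma> S i) = top_of_set (peak_block \<sigma> S i)"
    if "\<sigma> \<in> {1, - 1}" for \<sigma>
    using that by (auto simp: subtopology_subtopology intro!: arg_cong[where f = top_of_set])
  have "open {t :: 'a \<Rightarrow> real. 0 < \<sigma> * t i}" for \<sigma>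
    by (intro open_Collect_less continuous_intros continuous_on_product_coordinates)
  moreover have "peak_block \<sigma> S i = ?B \<inter> {t. 0 < \<sigma> * t i}" if "\<sigma> \<in> {1, - 1}" for \<sigma>
    using that by (auto simp: peak_block_def)
  ultimately have op: "openin (top_of_set ?B) (peak_block \<sigma> S i)" if "\<sigma> \<in> {1, - 1}" for \<sigma>
    using that openin_open_Int by metis
  have vanU: "cohomology_vanishes (Suc q) (subtopology (top_of_set ?B) (peak_block \<sigma> S i))"
    if "\<sigma> \<in> {1, - 1}" for \<sigma>
    unfolding sub[OF that] q[symmetric]
    by (rule cohomology_vanishes_peak_block) (use assms that in auto)
  have dis: "disjoint_family_on (\<lambda>\<sigma>. peak_block \<sigma> S i) {1, - 1}"
    by (auto simp: disjoint_family_on_def peak_block_def)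
  show ?thesis
    unfolding q
  proof (rule cohomology_vanishes_cover[OF op dis, where J = "{} :: unit set" and V = "\<lambda>_. {}"])
    show "topspace (top_of_set ?B) \<subseteq> \<Union>((\<lambda>\<sigma>. peak_block \<sigma> S i) ` {1, - 1}) \<union> \<Union>((\<lambda>_. {}) ` ({} :: unit set))"
      by auto
  qed (use vanU closed_cochain_0 in \<open>auto simp: disjoint_family_on_def\<close>)
qed

section \<open>Stereographic projection from the base point\<close>

text \<open>The coordinate of the circle that sends the base point to infinity, and its inverse.\<close>

definition circle_chart :: "complex \<Rightarrow> complex \<Rightarrow> real"
  where "circle_chart b x = Im (cnj b * x) / (1 - Re (cnj b * x))"

definition circle_param :: "complex \<Rightarrow> real \<Rightarrow> complex"
  where "circle_param b t = b * Complex ((t\<^sup>2 - 1) / (t\<^sup>2 + 1)) (2 * t / (t\<^sup>2 + 1))"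

context
  fixes b :: complex
  assumes b: "b \<in> sphere 0 1"
begin

lemma cnj_base_mult: "cnj b * b = 1" "cnj b * (b * z) = z" "b * (cnj b * z) = z"
proof -
  show 1: "cnj b * b = 1"
    using b complex_norm_square[of b] by (simp add: mult.commute)
  show "cnj b * (b * z) = z" "b * (cnj b * z) = z"
    using 1 by (simp_all flip: mult.assoc add: mult.commute[of b])
qed

lemma norm_cnj_base_mult [simp]: "norm (cnj b * x) = norm x" "norm (b * x) = norm x"
  using b by (simp_all add: norm_mult)

lemma Re_circle_param: "Re (cnj b * circle_param b t) = (t\<^sup>2 - 1) / (t\<^sup>2 + 1)"
  unfolding circle_param_def cnj_base_mult(2) by simp

lemma Im_circle_param: "Im (cnj b * circle_param b t) = 2 * t / (t\<^sup>2 + 1)"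
  unfolding circle_param_def cnj_base_mult(2) by simp

lemma sq_plus_1: "(t :: real)\<^sup>2 + 1 > 0"
  by (simp add: add_nonneg_pos)

lemma Re_circle_param_alt: "Re (cnj b * circle_param b t) = 1 - 2 / (t\<^sup>2 + 1)"
  unfolding Re_circle_param using sq_plus_1[of t] by (simp add: field_simps)

lemma Re_circle_param_less_1: "Re (cnj b * circle_param b t) < 1"
  unfolding Re_circle_param_alt using sq_plus_1[of t] by simp

lemma circle_param_in_sphere: "circle_param b t \<in> sphere 0 1"
proof -
  have "((t\<^sup>2 - 1) / (t\<^sup>2 + 1))\<^sup>2 + (2 * t / (t\<^sup>2 + 1))\<^sup>2 = 1"
  proof -
    have "((t\<^sup>2 - 1) / (t\<^sup>2 + 1))\<^sup>2 + (2 * t / (t\<^sup>2 + 1))\<^sup>2 = ((t\<^sup>2 - 1)\<^sup>2 + (2 * t)\<^sup>2) / (t\<^sup>2 + 1)\<^sup>2"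
      by (simp add: power_divide add_divide_distrib)
    also have "(t\<^sup>2 - 1)\<^sup>2 + (2 * t)\<^sup>2 = (t\<^sup>2 + 1)\<^sup>2"
      by (simp add: power2_eq_square algebra_simps)
    finally show ?thesis
      using sq_plus_1[of t] by simp
  qed
  then have "norm (Complex ((t\<^sup>2 - 1) / (t\<^sup>2 + 1)) (2 * t / (t\<^sup>2 + 1))) = 1"
    by (simp add: complex_norm)
  then show ?thesis
    by (simp add: circle_param_def)
qed

lemma Re_base: "Re (cnj b * b) = 1"
  by (simp add: cnj_base_mult)

lemma circle_param_ne_base: "circle_param b t \<noteq> b"
  using Re_circle_param_less_1[of t] Re_base by (metis less_irrefl)

lemma chart_param: "circle_chart b (circle_param b t) = t"
proof -
  have "1 - (t\<^sup>2 - 1) / (t\<^sup>2 + 1) = 2 / (t\<^sup>2 + 1)"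
    using sq_plus_1[of t] by (simp add: field_simps)
  then show ?thesis
    unfolding circle_chart_def Re_circle_param Im_circle_param using sq_plus_1[of t] by simp
qed

lemma Re_le_1: "x \<in> sphere 0 1 \<Longrightarrow> Re (cnj b * x) \<le> 1"
  using complex_Re_le_cmod[of "cnj b * x"] by simp

lemma Re_less_1:
  assumes "x \<in> sphere 0 1" "x \<noteq> b"
  shows "Re (cnj b * x) < 1"
proof -
  have "Re (cnj b * x) \<noteq> 1"
  proof
    assume 1: "Re (cnj b * x) = 1"
    have "(Re (cnj b * x))\<^sup>2 + (Im (cnj b * x))\<^sup>2 = 1"
      using assms(1) cmod_power2[of "cnj b * x"] by simp
    then have "Im (cnj b * x) = 0"
      unfolding 1 by simp
    then have "cnj b * x = 1"
      using 1 by (simp add: complex_eq_iff)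
    then have "b * (cnj b * x) = b"
      by simp
    then show False
      using assms(2) by (simp only: cnj_base_mult(3))
  qed
  then show ?thesis
    using Re_le_1[OF assms(1)] by simp
qed

lemma param_chart:
  assumes "x \<in> sphere 0 1" "x \<noteq> b"
  shows "circle_param b (circle_chart b x) = x"
proof -
  define w where "w = cnj b * x"
  have w: "(Re w)\<^sup>2 + (Im w)\<^sup>2 = 1" "Re w < 1"
    using assms cmod_power2[of w] Re_less_1[OF assms] by (simp_all add: w_def)
  define t where "t = Im w / (1 - Re w)"
  have t1: "t\<^sup>2 + 1 = 2 / (1 - Re w)"
  proof -
    have "t\<^sup>2 = (1 - (Re w)\<^sup>2) / (1 - Re w)\<^sup>2"
      using w by (simp add: t_def power_divide)
    also have "\<dots> = (1 + Re w) / (1 - Re w)"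
      using w(2) by (simp add: divide_simps) (simp add: power2_eq_square algebra_simps)
    finally show ?thesis
      using w(2) by (simp add: field_simps)
  qed
  have "(t\<^sup>2 - 1) / (t\<^sup>2 + 1) = 1 - 2 / (t\<^sup>2 + 1)"
    using sq_plus_1[of t] by (simp add: field_simps)
  also have "\<dots> = Re w"
    unfolding t1 using w(2) by (simp add: field_simps)
  finally have "(t\<^sup>2 - 1) / (t\<^sup>2 + 1) = Re w" .
  moreover have "2 * t / (t\<^sup>2 + 1) = Im w"
    unfolding t1 using w(2) by (simp add: t_def)
  ultimately have "circle_param b t = b * w"
    by (simp add: circle_param_def complex_eq_iff)
  then show ?thesis
    unfolding w_def cnj_base_mult(3) by (simp add: circle_chart_def t_def w_def)
qed

lemma continuous_on_chart: "continuous_on (sphere 0 1 - {b}) (circle_chart b)"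
proof -
  have "1 - Re (cnj b * x) \<noteq> 0" if "x \<in> sphere 0 1 - {b}" for x
    using Re_less_1[of x] that by auto
  then show ?thesis
    unfolding circle_chart_def by (intro continuous_intros) auto
qed

lemma continuous_on_param: "continuous_on UNIV (circle_param b)"
  unfolding circle_param_def Complex_eq
  by (intro continuous_intros) (use sq_plus_1 in \<open>auto simp: less_imp_neq[symmetric]\<close>)

text \<open>In the chart the rotated real part is \<open>1 - 2 / (t^2 + 1)\<close>, an increasing
  function of the absolute value of \<open>t\<close>: being nearer to the base point means being
  farther out on the line.\<close>

lemma Re_less_iff_chart:
  assumes "x \<in> sphere 0 1" "x \<noteq> b" "y \<in> sphere 0 1" "y \<noteq> b"
  shows "Re (cnj b * x) < Re (cnj b * y) \<longleftrightarrow> \<bar>circle_chart b x\<bar> < \<bar>circle_chart b y\<bar>"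
proof -
  have "Re (cnj b * circle_param b s) < Re (cnj b * circle_param b t) \<longleftrightarrow> \<bar>s\<bar> < \<bar>t\<bar>" for s t
  proof -
    have "2 / (t\<^sup>2 + 1) < 2 / (s\<^sup>2 + 1) \<longleftrightarrow> s\<^sup>2 < t\<^sup>2"
      using sq_plus_1[of t] sq_plus_1[of s] by (simp add: divide_less_eq less_divide_eq field_simps)
    then show ?thesis
      unfolding Re_circle_param_alt by (simp add: abs_le_square_iff flip: not_le)
  qed
  from this[of "circle_chart b x" "circle_chart b y"] show ?thesis
    by (simp only: param_chart[OF assms(1,2)] param_chart[OF assms(3,4)])
qed

text \<open>The sign of \<open>(t^2 - 1) / (t^2 + 1)\<close> changes at absolute value 1, which is
  the origin of the threshold in \<open>peak_block\<close>.\<close>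

lemma Re_pos_iff_chart:
  assumes "x \<in> sphere 0 1" "x \<noteq> b"
  shows "0 < Re (cnj b * x) \<longleftrightarrow> 1 < \<bar>circle_chart b x\<bar>"
proof -
  have "0 < Re (cnj b * circle_param b t) \<longleftrightarrow> 1 < \<bar>t\<bar>" for t
  proof -
    have "0 < (t\<^sup>2 - 1) / (t\<^sup>2 + 1) \<longleftrightarrow> 1 < t\<^sup>2"
      using sq_plus_1[of t] by (simp add: zero_less_divide_iff)
    then show ?thesis
      unfolding Re_circle_param using abs_square_le_1[of t] by linarith
  qed
  from this[of "circle_chart b x"] show ?thesis
    by (simp only: param_chart[OF assms])
qed

end

lemma ordered_triples_iff:
  fixes y :: "nat \<Rightarrow> 'a"
  shows "(\<forall>i j k. 1 \<le> i \<and> i < j \<and> j < k \<and> k \<le> n \<longrightarrow> \<not> (y i = y j \<and> y j = y k)) \<longleftrightarrow>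
    (\<forall>i\<in>{1..n}. \<forall>j\<in>{1..n}. \<forall>k\<in>{1..n}. i \<noteq> j \<and> j \<noteq> k \<and> i \<noteq> k \<longrightarrow> \<not> (y i = y j \<and> y j = y k))"
    (is "?L \<longleftrightarrow> ?R")
proof
  assume L: ?L
  show ?R
  proof (intro ballI impI notI)
    fix i j k
    assume *: "i \<in> {1..n}" "j \<in> {1..n}" "k \<in> {1..n}" "i \<noteq> j \<and> j \<noteq> k \<and> i \<noteq> k" "y i = y j \<and> y j = y k"
    then consider "i < j \<and> j < k" | "i < k \<and> k < j" | "j < i \<and> i < k" | "j < k \<and> k < i"
      | "k < i \<and> i < j" | "k < j \<and> j < i"
      by linarith
    then show False
      by cases (use L * in \<open>metis atLeastAtMost_iff\<close>)+
  qed
next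
  assume R: ?R
  show ?L
  proof (intro allI impI)
    fix i j k
    assume "1 \<le> i \<and> i < j \<and> j < k \<and> k \<le> n"
    then have "i \<in> {1..n}" "j \<in> {1..n}" "k \<in> {1..n}" "i \<noteq> j \<and> j \<noteq> k \<and> i \<noteq> k"
      by auto
    then show "\<not> (y i = y j \<and> y j = y k)"
      using R by blast
  qed
qed

text \<open>A triple containing the index \<open>n\<close>, whose point is fixed at
  \<open>b\<close>, becomes a pair of moving points at \<open>b\<close>; the other triples involve
  moving points only.\<close>

lemma in_no_triple_config_space:
  assumes "n \<ge> 1"
  shows "x \<in> topspace (no_triple_config_space n b) \<longleftrightarrow> x \<in> {1..<n} \<rightarrow>\<^sub>E sphere 0 1 \<and>
    (\<forall>i\<in>{1..<n}. \<forall>j\<in>{1..<n}. i \<noteq> j \<longrightarrow> \<not> (x i = b \<and> x j = b)) \<and>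
    (\<forall>i\<in>{1..<n}. \<forall>j\<in>{1..<n}. \<forall>k\<in>{1..<n}. i \<noteq> j \<and> j \<noteq> k \<and> i \<noteq> k \<longrightarrow> \<not> (x i = x j \<and> x j = x k))"
proof -
  define y where "y = x(n := b)"
  have yn: "y n = b" "n \<in> {1..n}"
    using assms by (auto simp: y_def)
  have y: "y j = x j" "j \<in> {1..n}" "j \<noteq> n" if "j \<in> {1..<n}" for j
    using that by (auto simp: y_def)
  have less: "j \<in> {1..<n}" if "j \<in> {1..n}" "j \<noteq> n" for j
    using that by auto
  have "(\<forall>i\<in>{1..n}. \<forall>j\<in>{1..n}. \<forall>k\<in>{1..n}. i \<noteq> j \<and> j \<noteq> k \<and> i \<noteq> k \<longrightarrow> \<not> (y i = y j \<and> y j = y k)) \<longleftrightarrow>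
    (\<forall>i\<in>{1..<n}. \<forall>j\<in>{1..<n}. i \<noteq> j \<longrightarrow> \<not> (x i = b \<and> x j = b)) \<and>
    (\<forall>i\<in>{1..<n}. \<forall>j\<in>{1..<n}. \<forall>k\<in>{1..<n}. i \<noteq> j \<and> j \<noteq> k \<and> i \<noteq> k \<longrightarrow> \<not> (x i = x j \<and> x j = x k))"
    (is "?L \<longleftrightarrow> ?R1 \<and> ?R2")
  proof (intro iffI conjI)
    assume L: ?L
    show ?R1
    proof (intro ballI impI)
      fix i j
      assume ij: "i \<in> {1..<n}" "j \<in> {1..<n}" "i \<noteq> j"
      then have "\<not> (y i = y j \<and> y j = y n)"
        using L y(2,3) yn(2) by blast
      then show "\<not> (x i = b \<and> x j = b)"
        using y(1)[OF ij(1)] y(1)[OF ij(2)] yn(1) by auto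
    qed
    show ?R2
    proof (intro ballI impI)
      fix i j k
      assume ijk: "i \<in> {1..<n}" "j \<in> {1..<n}" "k \<in> {1..<n}" "i \<noteq> j \<and> j \<noteq> k \<and> i \<noteq> k"
      then have "\<not> (y i = y j \<and> y j = y k)"
        using L y(2) by blast
      then show "\<not> (x i = x j \<and> x j = x k)"
        using y(1) ijk by simp
    qed
  next
    assume R: "?R1 \<and> ?R2"
    show ?L
    proof (intro ballI impI notI)
      fix i j k
      assume *: "i \<in> {1..n}" "j \<in> {1..n}" "k \<in> {1..n}" "i \<noteq> j \<and> j \<noteq> k \<and> i \<noteq> k"
        and eq: "y i = y j \<and> y j = y k"
      have pair: False if "l \<in> {1..<n}" "m \<in> {1..<n}" "l \<noteq> m" "y l = b" "y m = b" for l m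
        using R that y(1)[OF that(1)] y(1)[OF that(2)] by metis
      consider "i = n" | "j = n" | "k = n" | "i \<noteq> n" "j \<noteq> n" "k \<noteq> n"
        by blast
      then show False
      proof cases
        case 1
        show ?thesis
          by (rule pair[OF less less, of j k]) (use 1 * eq yn(1) in auto)
      next
        case 2
        show ?thesis
          by (rule pair[OF less less, of i k]) (use 2 * eq yn(1) in auto)
      next
        case 3
        show ?thesis
          by (rule pair[OF less less, of i j]) (use 3 * eq yn(1) in auto)
      next
        case 4
        then have "i \<in> {1..<n}" "j \<in> {1..<n}" "k \<in> {1..<n}"
          using * by auto
        then show ?thesis
          using R * eq y(1) by metis
      qed
    qed
  qed
  then show ?thesis
    by (simp only: topspace_no_triple_config_space mem_Collect_eq
        ordered_triples_iff[of n "x(n := b)"] y_def)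
qed

section \<open>The cover of the configuration space by position relative to the base point\<close>

locale circle_config =
  fixes n :: nat and b :: complex
  assumes b: "b \<in> sphere 0 1" and n: "n \<ge> 1"
begin

abbreviation "S \<equiv> {1..<n}"
abbreviation "Q \<equiv> no_triple_config_space n b"
text \<open>The real part after rotating \<open>b\<close> to 1. On the circle its maximum 1 is
  attained at \<open>b\<close> alone, so it measures nearness to the base point.\<close>

abbreviation "height x \<equiv> Re (cnj b * x)"

definition "away_from_base = {x \<in> topspace Q. \<forall>i\<in>S. x i \<noteq> b}"

text \<open>An open thickening of the stratum \<open>x i = b\<close>. Requiring \<open>i\<close> to
  be strictly nearest makes the sets for different \<open>i\<close> disjoint; positive height keeps
  \<open>x i\<close> off the antipode of \<open>b\<close>, so that it can be moved to
  \<open>b\<close>.\<close>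

definition "near_base i = {x \<in> topspace Q. 0 < height (x i) \<and> (\<forall>j\<in>S - {i}. height (x j) < height (x i))}"

lemma in_Q: "x \<in> topspace Q \<longleftrightarrow> x \<in> S \<rightarrow>\<^sub>E sphere 0 1 \<and>
    (\<forall>i\<in>S. \<forall>j\<in>S. i \<noteq> j \<longrightarrow> \<not> (x i = b \<and> x j = b)) \<and>
    (\<forall>i\<in>S. \<forall>j\<in>S. \<forall>k\<in>S. i \<noteq> j \<and> j \<noteq> k \<and> i \<noteq> k \<longrightarrow> \<not> (x i = x j \<and> x j = x k))"
  by (rule in_no_triple_config_space[OF n])

lemma Q_sphere: "x \<in> topspace Q \<Longrightarrow> i \<in> S \<Longrightarrow> x i \<in> sphere 0 1"
  unfolding in_Q by (auto simp: PiE_iff)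

lemma Q_eq: "Q = subtopology (torus n) (topspace Q)"
proof -
  have "topspace Q \<subseteq> topspace (torus n)"
    by (auto simp: no_triple_config_space_def)
  then show ?thesis
    by (metis no_triple_config_space_def topspace_subtopology subtopology_restrict)
qed

lemma continuous_map_coordinate:
  assumes "i \<in> S"
  shows "continuous_map (subtopology Q A) circle (\<lambda>x. x i)"
  unfolding no_triple_config_space_def torus_def
  by (intro continuous_map_from_subtopology continuous_map_product_projection assms)

lemma continuous_map_coordinate_Q: "i \<in> S \<Longrightarrow> continuous_map Q circle (\<lambda>x. x i)"
  using continuous_map_coordinate[of i UNIV] by simp

lemma continuous_map_into_Q:
  assumes A: "A \<subseteq> topspace Q" "f \<in> topspace X \<rightarrow> A"
    and f: "\<And>i. i \<in> S \<Longrightarrow> continuous_map X euclidean (\<lambda>x. f x i)"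
  shows "continuous_map X (subtopology Q A) f"
proof -
  have ext: "f x \<in> S \<rightarrow>\<^sub>E sphere 0 1" if "x \<in> topspace X" for x
    using that A unfolding in_Q[symmetric] by (metis (no_types, lifting) Pi_iff in_Q subsetD)
  have "continuous_map X (torus n) f"
    unfolding torus_def continuous_map_componentwise
  proof (intro conjI ballI)
    show "f ` topspace X \<subseteq> extensional S"
      using ext by (auto simp: PiE_iff)
    show "continuous_map X circle (\<lambda>x. f x i)" if "i \<in> S" for i
      using f[OF that] ext that by (auto simp: continuous_map_in_subtopology PiE_iff)
  qed
  then have "continuous_map X (subtopology (torus n) (topspace Q)) f"
    using A by (auto simp: continuous_map_in_subtopology)
  then show ?thesis
    using A(2) unfolding Q_eq[symmetric] by (simp add: continuous_map_in_subtopology)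
qed

lemma continuous_map_height: "i \<in> S \<Longrightarrow> continuous_map Q euclideanreal (\<lambda>x. height (x i))"
proof -
  assume "i \<in> S"
  have "continuous_map circle euclideanreal (\<lambda>z. height z)"
    unfolding continuous_map_iff_continuous by (intro continuous_intros)
  from continuous_map_compose[OF continuous_map_coordinate_Q[OF \<open>i \<in> S\<close>] this]
  show ?thesis
    by (simp add: o_def)
qed

lemma openin_away: "openin Q away_from_base"
  unfolding away_from_base_def
proof (rule openin_Collect_finite_all)
  fix i assume "i \<in> S"
  then have "continuous_map Q euclidean (\<lambda>x. x i)"
    using continuous_map_coordinate_Q continuous_map_into_fulltopology by blast
  from openin_continuous_map_preimage[OF this, of "- {b}"]
  show "openin Q {x \<in> topspace Q. x i \<noteq> b}"
    by (simp add: open_Compl)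
qed simp

lemma openin_near:
  assumes "i \<in> S"
  shows "openin Q (near_base i)"
proof -
  have "openin Q {x \<in> topspace Q. 0 < height (x i)}"
    by (rule openin_Collect_less) (use continuous_map_height[OF assms] in auto)
  moreover have "openin Q {x \<in> topspace Q. \<forall>j\<in>S - {i}. height (x j) < height (x i)}"
  proof (rule openin_Collect_finite_all)
    fix j assume "j \<in> S - {i}"
    then show "openin Q {x \<in> topspace Q. height (x j) < height (x i)}"
      using assms by (intro openin_Collect_less continuous_map_height) auto
  qed simp
  moreover have "near_base i = {x \<in> topspace Q. 0 < height (x i)}
      \<inter> {x \<in> topspace Q. \<forall>j\<in>S - {i}. height (x j) < height (x i)}"
    by (auto simp: near_base_def)
  ultimately show ?thesis
    by (simp add: openin_Int)
qed

lemma near_disjoint: "disjoint_family_on near_base S"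
  unfolding disjoint_family_on_def
proof (intro ballI impI)
  fix i j
  assume ij: "i \<in> S" "j \<in> S" "i \<noteq> j"
  have "height (x i) < height (x j) \<and> height (x j) < height (x i)" if "x \<in> near_base i \<inter> near_base j" for x
    using that ij unfolding near_base_def by blast
  then show "near_base i \<inter> near_base j = {}"
    by (meson all_not_in_conv less_asym)
qed

lemma near_ne_base:
  assumes "x \<in> near_base i" "i \<in> S" "j \<in> S - {i}"
  shows "x j \<noteq> b"
proof
  assume "x j = b"
  moreover have "height (x j) < height (x i)" "x \<in> topspace Q"
    using assms unfolding near_base_def by blast+
  ultimately have "1 < height (x i)" "x i \<in> sphere 0 1"
    using Re_base[OF b] Q_sphere[OF _ assms(2)] by simp_all
  then show False
    using Re_le_1[OF b, of "x i"] by linarith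
qed

text \<open>At most one moving point sits at \<open>b\<close>, since the fixed point is already
  there, and such a point alone has height 1.\<close>

lemma cover: "topspace Q \<subseteq> away_from_base \<union> \<Union>(near_base ` S)"
proof
  fix x assume x: "x \<in> topspace Q"
  show "x \<in> away_from_base \<union> \<Union>(near_base ` S)"
  proof (cases "\<exists>i\<in>S. x i = b")
    case True
    then obtain i where i: "i \<in> S" "x i = b" ..
    have "height (x j) < height (x i)" if "j \<in> S - {i}" for j
    proof -
      have "x j \<noteq> b"
        using x i that unfolding in_Q by blast
      then show ?thesis
        using Re_less_1[OF b, of "x j"] Q_sphere[OF x, of j] that i Re_base[OF b] by simp
    qed
    then have "x \<in> near_base i"
      using x i Re_base[OF b] by (auto simp: near_base_def)
    with i show ?thesis
      by blast
  qed (use x in \<open>auto simp: away_from_base_def\<close>)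
qed

text \<open>The value 0 outside \<open>T\<close> is an arbitrary choice of the coordinates that
  \<open>no_triple T\<close> leaves free.\<close>

definition "to_line T x = (\<lambda>i. if i \<in> T then circle_chart b (x i) else 0)"

definition "from_line t = restrict (\<lambda>i. circle_param b (t i)) S"

lemma continuous_map_to_line:
  assumes "T \<subseteq> S" "\<And>x i. x \<in> A \<Longrightarrow> i \<in> T \<Longrightarrow> x i \<noteq> b" "A \<subseteq> topspace Q" "\<And>x. x \<in> A \<Longrightarrow> to_line T x \<in> B"
  shows "continuous_map (subtopology Q A) (top_of_set B) (to_line T)"
proof -
  have "continuous_map (subtopology Q A) euclideanreal (\<lambda>x. to_line T x i)" for i
  proof (cases "i \<in> T")
    case True
    have "continuous_map (subtopology Q A) (top_of_set (sphere 0 1 - {b})) (\<lambda>x. x i)"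
    proof -
      have "continuous_map (subtopology Q A) euclidean (\<lambda>x. x i)"
        using continuous_map_coordinate[of i A] assms(1) True continuous_map_into_fulltopology by blast
      moreover have "x i \<in> sphere 0 1 - {b}" if "x \<in> A" for x
        using Q_sphere[of x i] assms(1-3) True that by blast
      ultimately show ?thesis
        by (auto simp: continuous_map_in_subtopology)
    qed
    moreover have "continuous_map (top_of_set (sphere 0 1 - {b})) euclideanreal (circle_chart b)"
      using continuous_on_chart[OF b] by simp
    ultimately have "continuous_map (subtopology Q A) euclideanreal (circle_chart b \<circ> (\<lambda>x. x i))"
      by (rule continuous_map_compose)
    then show ?thesis
      using True by (simp add: to_line_def o_def)
  qed (simp add: to_line_def)
  then have "continuous_map (subtopology Q A) euclidean (to_line T)"
    by (simp add: continuous_map_componentwise_UNIV flip: euclidean_product_topology)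
  then show ?thesis
    using assms(3,4) by (auto simp: continuous_map_in_subtopology)
qed

lemma continuous_map_param_coordinate: "continuous_map (top_of_set B) euclidean (\<lambda>t. circle_param b (t i))"
proof -
  have "continuous_on UNIV (\<lambda>t. circle_param b (t i))"
    by (rule continuous_on_compose2[OF continuous_on_param[OF b] continuous_on_product_coordinates]) auto
  then show ?thesis
    by (auto intro: continuous_on_subset)
qed

text \<open>On \<open>A\<close> the round trip through the chart is the identity. The opposite round
  trip resets the coordinates outside \<open>S\<close>, so the argument goes by domination instead
  of a homeomorphism.\<close>

lemma cohomology_vanishes_in_chart:
  assumes A: "A \<subseteq> away_from_base" "\<And>x. x \<in> A \<Longrightarrow> to_line S x \<in> B" "\<And>t. t \<in> B \<Longrightarrow> from_line t \<in> A"
    and van: "cohomology_vanishes p (top_of_set B)"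
  shows "cohomology_vanishes p (subtopology Q A)"
proof (rule cohomology_vanishes_dominated[OF _ _ _ van])
  have AQ: "A \<subseteq> topspace Q"
    using A(1) by (auto simp: away_from_base_def)
  have ne: "x i \<noteq> b" if "x \<in> A" "i \<in> S" for x i
    using that A(1) unfolding away_from_base_def by blast
  show r: "continuous_map (subtopology Q A) (top_of_set B) (to_line S)"
    by (rule continuous_map_to_line) (fact order_refl ne AQ A(2))+
  show s: "continuous_map (top_of_set B) (subtopology Q A) from_line"
    using AQ A(3) continuous_map_param_coordinate
    by (intro continuous_map_into_Q) (auto simp: from_line_def)
  have "from_line (to_line S x) = x" if "x \<in> A" for x
  proof
    fix i
    have x: "x \<in> topspace Q"
      using that AQ by blast
    show "from_line (to_line S x) i = x i"
    proof (cases "i \<in> S")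
      case True
      then have "x i \<noteq> b"
        using that ne by blast
      then show ?thesis
        using True param_chart[OF b Q_sphere[OF x True]] by (simp add: from_line_def to_line_def)
    next
      case False
      then show ?thesis
        using x unfolding in_Q by (auto simp: from_line_def PiE_iff extensional_def)
    qed
  qed
  then show "homotopic_with (\<lambda>_. True) (subtopology Q A) (subtopology Q A) (from_line \<circ> to_line S) id"
    using continuous_map_compose[OF r s] by (intro homotopic_with_equal) auto
qed

lemma to_line_no_triple:
  assumes "x \<in> topspace Q" "T \<subseteq> S" "\<And>i. i \<in> T \<Longrightarrow> x i \<noteq> b"
  shows "to_line T x \<in> no_triple T"
  unfolding no_triple_def
proof clarify
  fix i j k
  assume *: "i \<in> T" "j \<in> T" "k \<in> T" "i \<noteq> j" "j \<noteq> k" "i \<noteq> k"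
    "to_line T x i = to_line T x j" "to_line T x j = to_line T x k"
  have inj: "x l = x m" if "l \<in> T" "m \<in> T" "to_line T x l = to_line T x m" for l m
  proof -
    have "l \<in> S" "m \<in> S"
      using that assms(2) by auto
    then have inv: "circle_param b (circle_chart b (x l)) = x l" "circle_param b (circle_chart b (x m)) = x m"
      using param_chart[OF b Q_sphere[OF assms(1)]] assms(3) that by blast+
    have "circle_chart b (x l) = circle_chart b (x m)"
      using that by (simp add: to_line_def)
    with inv show ?thesis
      by metis
  qed
  have "x i = x j" "x j = x k"
    using inj[of i j] inj[of j k] * by auto
  moreover have "i \<in> S" "j \<in> S" "k \<in> S"
    using * assms(2) by auto
  ultimately show False
    using assms(1) * unfolding in_Q by blast
qed

lemma from_line_away:
  assumes "t \<in> no_triple S"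
  shows "from_line t \<in> away_from_base"
proof -
  have inj: "s = s'" if "circle_param b s = circle_param b s'" for s s'
    using that chart_param[OF b] by metis
  have "from_line t \<in> topspace Q"
    unfolding in_Q
  proof (intro conjI ballI impI notI)
    show "from_line t \<in> S \<rightarrow>\<^sub>E sphere 0 1"
      using circle_param_in_sphere[OF b] by (auto simp: from_line_def)
    show False if "i \<in> S" "from_line t i = b \<and> from_line t j = b" for i j
      using that circle_param_ne_base[OF b] by (simp add: from_line_def)
    show False if *: "i \<in> S" "j \<in> S" "k \<in> S" "i \<noteq> j \<and> j \<noteq> k \<and> i \<noteq> k"
      "from_line t i = from_line t j \<and> from_line t j = from_line t k" for i j k
    proof -
      have "t i = t j" "t j = t k"
        using * inj[of "t i" "t j"] inj[of "t j" "t k"] by (simp_all add: from_line_def)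
      then show False
        using assms * unfolding no_triple_def by blast
    qed
  qed
  then show ?thesis
    using circle_param_ne_base[OF b] by (auto simp: away_from_base_def from_line_def)
qed

lemma vanishes_away:
  assumes "cohomology_vanishes p (top_of_set (no_triple S))"
  shows "cohomology_vanishes p (subtopology Q away_from_base)"
  by (rule cohomology_vanishes_in_chart[OF order_refl _ from_line_away assms])
     (auto intro!: to_line_no_triple simp: away_from_base_def)

text \<open>The overlap falls into two pieces, as the point nearest to \<open>b\<close> may lie on
  either side of it; in the chart these are the two peak blocks.\<close>

lemma vanishes_away_near:
  assumes i: "i \<in> S" and "p > 0" and van: "cohomology_vanishes p (top_of_set (no_triple (S - {i})))"
  shows "cohomology_vanishes p (subtopology Q (away_from_base \<inter> near_base i))"
proof (rule cohomology_vanishes_in_chart)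
  show "cohomology_vanishes p (top_of_set (peak_block 1 S i \<union> peak_block (- 1) S i))"
    using cohomology_vanishes_peak_blocks[OF _ i \<open>p > 0\<close> van] by simp
  have peak: "peak_block 1 S i \<union> peak_block (- 1) S i
      = {t \<in> no_triple S. 1 < \<bar>t i\<bar> \<and> (\<forall>j\<in>S - {i}. \<bar>t j\<bar> < \<bar>t i\<bar>)}"
    by (auto simp: peak_block_def abs_if split: if_splits)
  show "to_line S x \<in> peak_block 1 S i \<union> peak_block (- 1) S i" if x: "x \<in> away_from_base \<inter> near_base i" for x
  proof -
    have xQ: "x \<in> topspace Q" and ne: "\<And>j. j \<in> S \<Longrightarrow> x j \<noteq> b"
      using x by (auto simp: away_from_base_def)
    have "1 < \<bar>to_line S x i\<bar>"
      using x i Re_pos_iff_chart[OF b Q_sphere[OF xQ i] ne[OF i]] by (simp add: near_base_def to_line_def)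
    moreover have "\<bar>to_line S x j\<bar> < \<bar>to_line S x i\<bar>" if "j \<in> S - {i}" for j
    proof -
      have j: "j \<in> S"
        using that by simp
      have "height (x j) < height (x i)"
        using x that by (simp add: near_base_def)
      then show ?thesis
        using Re_less_iff_chart[OF b Q_sphere[OF xQ j] ne[OF j] Q_sphere[OF xQ i] ne[OF i]] i j
        by (simp add: to_line_def)
    qed
    ultimately show ?thesis
      unfolding peak using to_line_no_triple[OF xQ order_refl] ne by blast
  qed
  show "from_line t \<in> away_from_base \<inter> near_base i" if t: "t \<in> peak_block 1 S i \<union> peak_block (- 1) S i" for t
  proof -
    have t': "t \<in> no_triple S" "1 < \<bar>t i\<bar>" "\<And>j. j \<in> S - {i} \<Longrightarrow> \<bar>t j\<bar> < \<bar>t i\<bar>"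
      using t unfolding peak by auto
    have away: "from_line t \<in> away_from_base"
      by (rule from_line_away[OF t'(1)])
    have "0 < height (circle_param b (t i))"
      using t'(2) Re_pos_iff_chart[OF b circle_param_in_sphere[OF b] circle_param_ne_base[OF b]]
      by (simp only: chart_param[OF b])
    moreover have "height (circle_param b (t j)) < height (circle_param b (t i))" if "j \<in> S - {i}" for j
      using t'(3)[OF that] Re_less_iff_chart[OF b circle_param_in_sphere[OF b] circle_param_ne_base[OF b]
          circle_param_in_sphere[OF b] circle_param_ne_base[OF b]]
      by (simp only: chart_param[OF b])
    ultimately show ?thesis
      using away i by (auto simp: near_base_def away_from_base_def from_line_def)
  qed
qed auto

text \<open>Being strictly nearest to \<open>b\<close>, point \<open>i\<close> coincides with no
  other point and keeps the others off \<open>b\<close>; what remains is the condition on triples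
  without \<open>i\<close>.\<close>

lemma in_near_base:
  assumes i: "i \<in> S"
  shows "x \<in> near_base i \<longleftrightarrow> x \<in> S \<rightarrow>\<^sub>E sphere 0 1 \<and> 0 < height (x i)
    \<and> (\<forall>j\<in>S - {i}. height (x j) < height (x i))
    \<and> (\<forall>j\<in>S - {i}. \<forall>k\<in>S - {i}. \<forall>l\<in>S - {i}. j \<noteq> k \<and> k \<noteq> l \<and> j \<noteq> l \<longrightarrow> \<not> (x j = x k \<and> x k = x l))"
    (is "_ \<longleftrightarrow> ?R")
proof
  assume x: "x \<in> near_base i"
  then have "x \<in> topspace Q"
    by (simp add: near_base_def)
  note xQ = this[unfolded in_Q]
  show ?R
  proof (intro conjI ballI impI)
    show "x \<in> S \<rightarrow>\<^sub>E sphere 0 1"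
      by (rule conjunct1[OF xQ])
    show "0 < height (x i)" "j \<in> S - {i} \<Longrightarrow> height (x j) < height (x i)" for j
      using x unfolding near_base_def by blast+
    fix j k l
    assume "j \<in> S - {i}" "k \<in> S - {i}" "l \<in> S - {i}" "j \<noteq> k \<and> k \<noteq> l \<and> j \<noteq> l"
    then have "j \<in> S" "k \<in> S" "l \<in> S" "j \<noteq> k \<and> k \<noteq> l \<and> j \<noteq> l"
      by auto
    then show "\<not> (x j = x k \<and> x k = x l)"
      using conjunct2[OF conjunct2[OF xQ]] by metis
  qed
next
  assume R: ?R
  have ne: "x j \<noteq> x i" if "j \<in> S - {i}" for j
  proof -
    have "height (x j) < height (x i)"
      using R that by blast
    then show ?thesis
      by auto
  qed
  have ne_b: "x j \<noteq> b" if "j \<in> S - {i}" for j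
  proof
    assume "x j = b"
    moreover have "height (x j) < height (x i)" "x i \<in> sphere 0 1"
      using R that i by (blast, blast dest: PiE_mem)
    ultimately have "1 < height (x i)"
      using Re_base[OF b] by simp
    then show False
      using Re_le_1[OF b \<open>x i \<in> sphere 0 1\<close>] by linarith
  qed
  have "x \<in> topspace Q"
    unfolding in_Q
  proof (intro conjI ballI impI notI)
    show "x \<in> S \<rightarrow>\<^sub>E sphere 0 1"
      using R by simp
    show False if "j \<in> S" "k \<in> S" "j \<noteq> k" "x j = b \<and> x k = b" for j k
      using that ne_b[of j] ne_b[of k] by blast
    show False if *: "j \<in> S" "k \<in> S" "l \<in> S" "j \<noteq> k \<and> k \<noteq> l \<and> j \<noteq> l" "x j = x k \<and> x k = x l" for j k l
    proof -
      have "j \<noteq> i \<and> k \<noteq> i \<and> l \<noteq> i"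
        using ne[of j] ne[of k] ne[of l] * by auto
      then have "j \<in> S - {i}" "k \<in> S - {i}" "l \<in> S - {i}"
        using * by auto
      then show False
        using R * by metis
    qed
  qed
  then show "x \<in> near_base i"
    unfolding near_base_def using R by blast
qed

text \<open>The normalised segment from \<open>z\<close> to the base point moves monotonically towards it.\<close>

definition "slide u z = ((1 - u) *\<^sub>R b + u *\<^sub>R z) /\<^sub>R norm ((1 - u) *\<^sub>R b + u *\<^sub>R z)"

lemma height_segment:
  assumes z: "z \<in> sphere 0 1" "0 < height z" and u: "0 \<le> u" "u \<le> 1"
  shows "height z \<le> height ((1 - u) *\<^sub>R b + u *\<^sub>R z)"
proof -
  have "height ((1 - u) *\<^sub>R b + u *\<^sub>R z) = (1 - u) * height b + u * height z"
    by (simp add: algebra_simps)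
  also have "\<dots> = height z + (1 - u) * (1 - height z)"
    unfolding Re_base[OF b] by (simp add: algebra_simps)
  finally show ?thesis
    using u Re_le_1[OF b z(1)] by simp
qed

lemma segment_nonzero:
  assumes "z \<in> sphere 0 1" "0 < height z" "0 \<le> u" "u \<le> 1"
  shows "(1 - u) *\<^sub>R b + u *\<^sub>R z \<noteq> 0"
proof
  assume "(1 - u) *\<^sub>R b + u *\<^sub>R z = 0"
  then have "height ((1 - u) *\<^sub>R b + u *\<^sub>R z) = 0"
    by (simp only: mult_zero_right complex.sel zero_complex.sel)
  then show False
    using height_segment[OF assms] assms(2) by simp
qed

lemma slide_in_sphere:
  assumes "z \<in> sphere 0 1" "0 < height z" "0 \<le> u" "u \<le> 1"
  shows "slide u z \<in> sphere 0 1"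
  using segment_nonzero[OF assms] by (simp add: slide_def)

text \<open>The segment itself does not lower the height, and normalising divides a positive height
  by a norm of at most 1.\<close>

lemma height_slide:
  assumes z: "z \<in> sphere 0 1" "0 < height z" and u: "0 \<le> u" "u \<le> 1"
  shows "height z \<le> height (slide u z)"
proof -
  let ?y = "(1 - u) *\<^sub>R b + u *\<^sub>R z"
  have "norm ?y \<le> (1 - u) * norm b + u * norm z"
    using norm_triangle_ineq[of "(1 - u) *\<^sub>R b" "u *\<^sub>R z"] u by simp
  then have "norm ?y \<le> 1"
    using z b by simp
  moreover have "0 < norm ?y"
    using segment_nonzero[OF assms] by simp
  ultimately have "1 \<le> inverse (norm ?y)"
    by (simp add: one_le_inverse_iff)
  then have "height ?y \<le> inverse (norm ?y) * height ?y"
    using height_segment[OF assms] z(2) mult_right_mono[of 1 "inverse (norm ?y)" "height ?y"] by simp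
  moreover have "height (slide u z) = inverse (norm ?y) * height ?y"
    unfolding slide_def by (simp only: mult_scaleR_right scaleR_complex.sel)
  ultimately show ?thesis
    using height_segment[OF assms] by simp
qed

lemma vanishes_near:
  assumes i: "i \<in> S" and van: "cohomology_vanishes p (top_of_set (no_triple (S - {i})))"
  shows "cohomology_vanishes p (subtopology Q (near_base i))"
proof (rule cohomology_vanishes_dominated[OF _ _ _ van])
  let ?N = "near_base i" and ?T = "S - {i}"
  have NQ: "?N \<subseteq> topspace Q"
    by (auto simp: near_base_def)
  define s where "s t = (from_line t)(i := b)" for t
  show r: "continuous_map (subtopology Q ?N) (top_of_set (no_triple ?T)) (to_line ?T)"
  proof (rule continuous_map_to_line)
    show "to_line ?T x \<in> no_triple ?T" if "x \<in> ?N" for x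
      using that NQ near_ne_base[OF that i] by (intro to_line_no_triple) auto
  qed (use NQ near_ne_base i in auto)
  have s_near: "s t \<in> ?N" if t: "t \<in> no_triple ?T" for t
    unfolding in_near_base[OF i]
  proof (intro conjI ballI impI notI)
    show "s t \<in> S \<rightarrow>\<^sub>E sphere 0 1"
      using circle_param_in_sphere[OF b] b i by (auto simp: s_def from_line_def)
    show "0 < height (s t i)"
      using Re_base[OF b] by (simp add: s_def)
    show "height (s t j) < height (s t i)" if "j \<in> ?T" for j
      using that Re_base[OF b] Re_circle_param_less_1[OF b, of "t j"] by (auto simp: s_def from_line_def)
    show False if *: "j \<in> ?T" "k \<in> ?T" "l \<in> ?T" "j \<noteq> k \<and> k \<noteq> l \<and> j \<noteq> l" "s t j = s t k \<and> s t k = s t l" for j k l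
    proof -
      have "circle_param b (t j) = circle_param b (t k)" "circle_param b (t k) = circle_param b (t l)"
        using * by (auto simp: s_def from_line_def)
      then have "t j = t k" "t k = t l"
        using chart_param[OF b] by metis+
      then show False
        using t * unfolding no_triple_def by blast
    qed
  qed
  show "continuous_map (top_of_set (no_triple ?T)) (subtopology Q ?N) s"
  proof (rule continuous_map_into_Q[OF NQ])
    show "continuous_map (top_of_set (no_triple ?T)) euclidean (\<lambda>t. s t k)" if "k \<in> S" for k
      using that continuous_map_param_coordinate[of "no_triple ?T" k]
      by (cases "k = i") (auto simp: s_def from_line_def)
  qed (use s_near in auto)
  define h where "h p = (snd p)(i := slide (fst p) (snd p i))" for p :: "real \<times> (nat \<Rightarrow> complex)"
  have in_sphere: "x i \<in> sphere 0 1" "0 < height (x i)" if "x \<in> ?N" for x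
    using that i NQ Q_sphere[of x i] by (auto simp: near_base_def)
  have h_near: "h (u, x) \<in> ?N" if x: "x \<in> ?N" and u: "0 \<le> u" "u \<le> 1" for u x
  proof -
    note sl = slide_in_sphere[OF in_sphere[OF x] u] height_slide[OF in_sphere[OF x] u]
    have xN: "x \<in> S \<rightarrow>\<^sub>E sphere 0 1" "0 < height (x i)" "\<forall>j\<in>?T. height (x j) < height (x i)"
      "\<forall>j\<in>?T. \<forall>k\<in>?T. \<forall>l\<in>?T. j \<noteq> k \<and> k \<noteq> l \<and> j \<noteq> l \<longrightarrow> \<not> (x j = x k \<and> x k = x l)"
      using x unfolding in_near_base[OF i] by blast+
    have hk: "h (u, x) k = x k" if "k \<in> ?T" for k
      using that by (simp add: h_def)
    show ?thesis
      unfolding in_near_base[OF i]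
    proof (intro conjI ballI impI notI)
      show "h (u, x) \<in> S \<rightarrow>\<^sub>E sphere 0 1"
        using xN(1) sl(1) i by (auto simp: h_def PiE_iff extensional_def)
      show "0 < height (h (u, x) i)"
        using sl(2) xN(2) unfolding h_def by simp
      show "height (h (u, x) j) < height (h (u, x) i)" if "j \<in> ?T" for j
      proof -
        have "height (x j) < height (x i)"
          using xN(3) that by blast
        then have "height (x j) < height (slide u (x i))"
          using sl(2) by linarith
        then show ?thesis
          using that by (simp add: h_def)
      qed
      show False if *: "j \<in> ?T" "k \<in> ?T" "l \<in> ?T" "j \<noteq> k \<and> k \<noteq> l \<and> j \<noteq> l"
        "h (u, x) j = h (u, x) k \<and> h (u, x) k = h (u, x) l" for j k l
        using * xN(4) hk[OF *(1)] hk[OF *(2)] hk[OF *(3)] by metis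
    qed
  qed
  have "homotopic_with (\<lambda>_. True) (subtopology Q ?N) (subtopology Q ?N) (h \<circ> Pair 0) (h \<circ> Pair 1)"
    unfolding homotopic_with_def
  proof (intro exI[of _ h] conjI)
    let ?C = "cylinder_space (subtopology Q ?N)"
    show "continuous_map ?C (subtopology Q ?N) h"
    proof (rule continuous_map_into_Q[OF NQ])
      show "h \<in> topspace ?C \<rightarrow> ?N"
        using h_near by auto
      fix k assume k: "k \<in> S"
      have coord: "continuous_map ?C euclidean (\<lambda>p. snd p k)" if "k \<in> S" for k
      proof -
        have "continuous_map (subtopology Q ?N) euclidean (\<lambda>x. x k)"
          using continuous_map_coordinate[OF that] continuous_map_into_fulltopology by blast
        from continuous_map_compose[OF continuous_map_snd this] show ?thesis
          by (simp add: o_def)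
      qed
      show "continuous_map ?C euclidean (\<lambda>p. h p k)"
      proof (cases "k = i")
        case False
        then show ?thesis
          using coord[OF k] by (simp add: h_def)
      next
        case True
        have u: "continuous_map ?C euclideanreal fst"
          using continuous_map_fst continuous_map_into_fulltopology by blast
        \<comment> \<open>Normalisation is continuous only where the segment misses the origin;
          positive height of \<open>x i\<close> guarantees this along the whole homotopy.\<close>
        let ?D = "{(u, z). (1 - u) *\<^sub>R b + u *\<^sub>R z \<noteq> 0}"
        have "continuous_map ?C (prod_topology euclidean euclidean) (\<lambda>p. (fst p, snd p i))"
          unfolding continuous_map_pairwise using u coord[OF i] by (simp add: o_def)
        then have "continuous_map ?C (top_of_set ?D) (\<lambda>p. (fst p, snd p i))"
          using segment_nonzero in_sphere by (auto simp: continuous_map_in_subtopology)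
        moreover have "continuous_map (top_of_set ?D) euclidean (\<lambda>(u, z). slide u z)"
          unfolding slide_def case_prod_unfold by (auto intro!: continuous_intros)
        ultimately have "continuous_map ?C euclidean ((\<lambda>(u, z). slide u z) \<circ> (\<lambda>p. (fst p, snd p i)))"
          by (rule continuous_map_compose)
        then show ?thesis
          using True by (simp add: h_def o_def)
      qed
    qed
  qed auto
  then show "homotopic_with (\<lambda>_. True) (subtopology Q ?N) (subtopology Q ?N) (s \<circ> to_line ?T) id"
  proof (rule homotopic_with_eq)
    fix x assume "x \<in> topspace (subtopology Q ?N)"
    then have x: "x \<in> ?N" "x \<in> topspace Q"
      by auto
    have "slide 1 (x i) = x i" "slide 0 (x i) = b"
      using in_sphere[OF x(1)] b by (simp_all add: slide_def)
    moreover have "from_line (to_line ?T x) k = x k" if "k \<noteq> i" for k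
    proof (cases "k \<in> S")
      case True
      then show ?thesis
        using that near_ne_base[OF x(1) i, of k] param_chart[OF b Q_sphere[OF x(2) True]]
        by (simp add: from_line_def to_line_def)
    next
      case False
      then show ?thesis
        using x(2) unfolding in_Q by (auto simp: from_line_def PiE_iff extensional_def)
    qed
    ultimately show "(s \<circ> to_line ?T) x = (h \<circ> Pair 0) x" "id x = (h \<circ> Pair 1) x"
      by (auto simp: h_def s_def fun_eq_iff)
  qed auto
qed

text \<open>One large open set faces the disjoint family \<open>near_base\<close>. Both sides vanish
  in degree \<open>p\<close>, and the overlaps vanish already in degree \<open>p - 1\<close>, so no
  extension argument is involved here.\<close>

theorem cohomology_vanishes_config_space:
  assumes "(n + 1) div 3 < p"
  shows "cohomology_vanishes p Q"
proof -
  obtain q where q: "p = Suc q"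
    using assms by (cases p) auto
  have card1: "card (S - {i}) div 3 < q" "2 \<le> n" if "i \<in> S" for i
  proof -
    have "card (S - {i}) = n - 2" "2 \<le> n"
      using that by auto
    \<comment> \<open>This identity produces the bound: \<open>n - 2\<close> free points on the
      overlaps, and one degree gained from the connecting map. The condition
      \<open>2 \<le> n\<close> keeps the natural subtraction honest.\<close>
    moreover have "(n + 1) div 3 = (n - 2) div 3 + 1"
      using \<open>2 \<le> n\<close> by presburger
    ultimately show "card (S - {i}) div 3 < q" "2 \<le> n"
      using assms by (simp_all add: q)
  qed
  have van: "cohomology_vanishes r (top_of_set (no_triple (S - {i})))" if "i \<in> S" "q \<le> r" for i r
    using card1(1)[OF that(1)] that(2) by (intro cohomology_vanishes_no_triple) auto
  have "card S div 3 < p"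
    using assms div_le_mono[of "n - 1" "n + 1" 3] by simp
  then have vanU: "cohomology_vanishes (Suc q) (subtopology Q away_from_base)"
    unfolding q by (intro vanishes_away cohomology_vanishes_no_triple) auto
  have vanV: "cohomology_vanishes (Suc q) (subtopology Q (near_base i))" if "i \<in> S" for i
    using that by (intro vanishes_near van) auto
  have vanW: "cohomology_vanishes q (subtopology Q (away_from_base \<inter> near_base i))" if "i \<in> S" for i
    using that card1(1)[OF that] by (intro vanishes_away_near van) auto
  \<comment> \<open>All overlap classes are zero in degree \<open>q\<close>, so the zero cochain
    realises them.\<close>
  have surj: "\<exists>a. closed_cochain q (subtopology Q away_from_base) a \<and>
      (\<forall>j\<in>S. exact_cochain q (subtopology Q (away_from_base \<inter> near_base j)) (\<lambda>s. w j s - a s))"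
    if "\<And>j. j \<in> S \<Longrightarrow> closed_cochain q (subtopology Q (away_from_base \<inter> near_base j)) (w j)" for w
    using that vanW closed_cochain_0
    by (intro exI[of _ "\<lambda>s. 0"]) (simp add: cohomology_vanishes_def)
  show ?thesis
    unfolding q
  proof (rule cohomology_vanishes_cover[where U = "\<lambda>_ :: unit. away_from_base" and I = UNIV, OF _ _ openin_near near_disjoint])
    show "topspace Q \<subseteq> \<Union> (range (\<lambda>_ :: unit. away_from_base)) \<union> \<Union> (near_base ` S)"
      using cover by auto
  qed (use openin_away vanU vanV surj in \<open>auto simp: disjoint_family_on_def\<close>)
qed

end

theorem theorem7:
  fixes n i :: nat and b :: complex
  assumes "b \<in> sphere 0 1"
    and "n \<ge> 1"
    and "int i > \<lfloor>(real n + 1) / 3\<rfloor>"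
  shows "trivial_group (cohomology_group i (no_triple_config_space n b) integer_group)"
proof -
  interpret circle_config n b
    using assms by unfold_locales
  have "\<lfloor>(real n + 1) / 3\<rfloor> = int ((n + 1) div 3)"
    using floor_divide_of_nat_eq[of "n + 1" 3, where 'a = real] by (simp add: add.commute)
  then have "(n + 1) div 3 < i"
    using assms(3) by simp
  then show ?thesis
    by (intro trivial_cohomology_group cohomology_vanishes_config_space) auto
qed

end
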